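(* Let $n\ge 2$, $\sigma\in(0,1)$, and let $J:\mathbb{R}^n\times\mathbb{R}^n\to[0,\infty)$ be a bounded, nonnegative, continuous, symmetric function ($J(x,y)=J(y,x)$) such that (i) for every $y\in\mathbb{R}^n$ the function $x\mapsto J(x,y)$ belongs to $L^1(\mathbb{R}^n)$; (ii) there are constants $c_1,c_2>0$ such that $J(x,y)\ge c_1|x-y|^{-(n+2\sigma)}$ whenever $|x-y|>c_2$. For $u_0\in L^1(\mathbb{R}^n)\cap L^\infty(\mathbb{R}^n)$ let $u$ denote the solution of $$\partial_t u(t,x)=\int_{\mathbb{R}^n}J(x,y)\,[u(t,y)-u(t,x)]\,dy,\qquad u(0,x)=u_0(x).$$ Let $q\in(1,2\sigma]$. Then there is a constant $C>0$ independent of $u_0$ such that $$\limsup_{t\to\infty}\; t^{\frac{n}{2\sigma}\left(1-\frac1q\right)}\|u(t,\cdot)\|_{L^q(\mathbb{R}^n)}\le C\,\|u_0\|_{L^1(\mathbb{R}^n)}.$$ Moreover, for every $r\in(2\sigma,+\infty)$ there is a constant $C>0$ independent of $u_0$ and $t$ such that for all $t>0$ $$\|u(t,\cdot)\|_{L^q(\mathbb{R}^n)}\le C\,\max\{\|u_0\|_{L^1(\mathbb{R}^n)},\|u_0\|_{L^r(\mathbb{R}^n)}\}\;t^{-\frac{n}{2\sigma}\left(1-\frac1q\right)}.$$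
   Context: "The solution" of the Cauchy problem is the solution $u\in C([0,+\infty),L^1(\mathbb{R}^n)\cap L^\infty(\mathbb{R}^n))$ with $u(0,\cdot)=u_0$ given by the following well-posedness result, recalled from the literature: for $J$ as in the claim and $u_0\in L^1(\mathbb{R}^n)\cap L^\infty(\mathbb{R}^n)$ there is a unique solution $u$ in this class, and it satisfies $\|u(t,\cdot)\|_{L^1(\mathbb{R}^n)}\le\|u_0\|_{L^1(\mathbb{R}^n)}$ and $\|u(t,\cdot)\|_{L^\infty(\mathbb{R}^n)}\le\|u_0\|_{L^\infty(\mathbb{R}^n)}$ for all $t\ge0$. *)

theory Defs
  imports "HOL-Analysis.Analysis" "HOL-Probability.Essential_Supremum"
begin

text \<open>The Bochner integral of a non-integrable function is 0, so \<open>Lp_norm p f\<close> is the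
  \<open>L\<^sup>p\<close> norm only for \<open>f \<in> L\<^sup>p\<close>. Below it is only applied, with \<open>p \<ge> 1\<close>, to functions in
  \<open>L\<^sup>1 \<inter> L\<^sup>\<infinity>\<close>, which lie in every \<open>L\<^sup>p\<close>.\<close>

definition Lp_norm :: "real \<Rightarrow> ('a::euclidean_space \<Rightarrow> real) \<Rightarrow> real" where
  "Lp_norm p f = (\<integral>x. \<bar>f x\<bar> powr p \<partial>lebesgue) powr (1 / p)"

definition Linf_norm :: "('a::euclidean_space \<Rightarrow> real) \<Rightarrow> ereal" where
  "Linf_norm f = esssup lebesgue (\<lambda>x. ereal \<bar>f x\<bar>)"

definition L1_Linf :: "('a::euclidean_space \<Rightarrow> real) set" where
  "L1_Linf = {f. integrable lebesgue f \<and> Linf_norm f < \<infinity>}"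

text \<open>Membership of \<open>u\<close> in \<open>C([0,\<infinity>), L\<^sup>1 \<inter> L\<^sup>\<infinity>)\<close>, the intersection carrying the sum (or maximum)
  of the two norms.\<close>

definition C_L1_Linf :: "(real \<Rightarrow> 'a::euclidean_space \<Rightarrow> real) \<Rightarrow> bool" where
  "C_L1_Linf u \<longleftrightarrow>
     (\<forall>t\<ge>0. u t \<in> L1_Linf) \<and>
     (\<forall>t\<ge>0. ((\<lambda>s. Lp_norm 1 (\<lambda>x. u s x - u t x)) \<longlongrightarrow> 0) (at t within {0..})) \<and>
     (\<forall>t\<ge>0. ((\<lambda>s. Linf_norm (\<lambda>x. u s x - u t x)) \<longlongrightarrow> 0) (at t within {0..}))"

text \<open>Elements of \<open>L\<^sup>1 \<inter> L\<^sup>\<infinity>\<close> are represented by functions, so the equation is required for almost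
  every \<open>x\<close>, with an exceptional set not depending on \<open>t\<close>. This costs no generality: since
  \<open>u\<close> is continuous in time with values in \<open>L\<^sup>\<infinity>\<close>, it has a representative that is continuous
  in \<open>t\<close> for almost every \<open>x\<close>.\<close>

definition nonlocal_solution ::
    "('a::euclidean_space \<Rightarrow> 'a \<Rightarrow> real) \<Rightarrow> ('a \<Rightarrow> real) \<Rightarrow> (real \<Rightarrow> 'a \<Rightarrow> real) \<Rightarrow> bool" where
  "nonlocal_solution J u0 u \<longleftrightarrow>
     C_L1_Linf u \<and>
     (AE x in lebesgue. u 0 x = u0 x) \<and>
     (AE x in lebesgue. \<forall>t>0.
        ((\<lambda>s. u s x) has_real_derivative (\<integral>y. J x y * (u t y - u t x) \<partial>lebesgue)) (at t))"

end

theory Submission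
  imports Defs
begin

text \<open>The decay is proved directly in \<open>L\<^sup>q\<close>. Averaging \<open>\<bar>w x\<bar>\<^sup>q\<close> against the values of \<open>w\<close> on the annulus
  of radius \<open>\<rho> \<ge> c2\<close> around \<open>x\<close>, where \<open>J\<close> is bounded below, gives a Nash-type inequality
  \<open>\<parallel>w\<parallel>\<^sub>q\<^sup>q \<le> C \<rho>\<^sup>2\<^sup>\<sigma> D(w) + C \<rho>\<^sup>-\<^sup>n\<^sup>(\<^sup>q\<^sup>-\<^sup>1\<^sup>) \<parallel>w\<parallel>\<^sub>1\<^sup>q\<close> in terms of the dissipation \<open>D\<close> of the \<open>L\<^sup>q\<close> norm.
  Integrating it over \<open>[s, 2s]\<close> with \<open>\<rho>\<^sup>2\<^sup>\<sigma>\<close> a small multiple of \<open>s\<close> yields, for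
  \<open>z s = s\<^sup>\<alpha> \<parallel>u s\<parallel>\<^sub>q\<^sup>q\<close> with \<open>\<alpha> = n(q - 1)/(2\<sigma>)\<close>, the recursion \<open>z (2s) \<le> z s / 2 + K \<parallel>u0\<parallel>\<^sub>1\<^sup>q\<close> for large \<open>s\<close>,
  hence the claim.

  The total rate \<open>\<integral> J x y dy\<close> may be unbounded in \<open>x\<close>, so the energy identity is proved for
  functions \<open>f (u t x)\<close> whose derivative \<open>\<phi>\<close> vanishes on \<open>[-k, k]\<close>: where
  \<open>J x y * \<phi> (u x) * (u y - u x)\<close> is positive, both \<open>\<bar>u x\<bar>\<close> and \<open>\<bar>u y\<bar>\<close> exceed \<open>k\<close>, a set of finite
  measure on which \<open>J\<close> is bounded; the negative part is then integrable for free. Accordingly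
  all estimates are made for the soft threshold \<open>shrink k u\<close>, uniformly in \<open>k\<close>, and \<open>k \<rightarrow> 0\<close> at the end.\<close>

subsection \<open>Soft thresholds and signed powers\<close>

text \<open>For \<open>k \<ge> 0\<close> this is soft thresholding. It is written as a difference of
  two positive parts because powers of its modulus then split into one-sided powers that are
  differentiated separately.\<close>

definition shrink :: "real \<Rightarrow> real \<Rightarrow> real" where
  "shrink k s = max (s - k) 0 - max (- s - k) 0"

text \<open>The odd power function; for p > 1, \<open>spow (p - 1)\<close> is the derivative of
  |s|^p divided by p.\<close>

definition spow :: "real \<Rightarrow> real \<Rightarrow> real" where
  "spow p s = sgn s * \<bar>s\<bar> powr p"

lemma abs_shrink: "0 \<le> k \<Longrightarrow> \<bar>shrink k s\<bar> = max (\<bar>s\<bar> - k) 0"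
  by (auto simp: shrink_def)

lemma abs_shrink_le: "0 \<le> k \<Longrightarrow> \<bar>shrink k s\<bar> \<le> \<bar>s\<bar>"
  by (auto simp: shrink_def)

lemma shrink_eq_0: "\<bar>s\<bar> \<le> k \<Longrightarrow> shrink k s = 0"
  by (auto simp: shrink_def)

lemma shrink_mono: "a \<le> b \<Longrightarrow> shrink k a \<le> shrink k b"
  by (auto simp: shrink_def)

lemma shrink_Lipschitz: "0 \<le> k \<Longrightarrow> a \<le> b \<Longrightarrow> shrink k b - shrink k a \<le> b - a"
  by (auto simp: shrink_def)

lemma spow_mono:
  assumes "0 < p" "a \<le> b" shows "spow p a \<le> spow p b"
proof -
  consider "0 \<le> a" | "a < 0" "0 \<le> b" | "b < 0" using assms by linarith
  then show ?thesis
  proof cases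
    case 1
    then have "a powr p \<le> b powr p" using assms by (intro powr_mono2) auto
    then show ?thesis using 1 assms by (cases "a = 0"; cases "b = 0") (auto simp: spow_def)
  next
    case 2
    then show ?thesis by (cases "b = 0") (auto simp: spow_def intro: order_trans[of _ 0])
  next
    case 3
    then have "(-b) powr p \<le> (-a) powr p" using assms by (intro powr_mono2) auto
    then show ?thesis using 3 assms by (auto simp: spow_def)
  qed
qed

lemma abs_spow: "\<bar>spow p s\<bar> = \<bar>s\<bar> powr p"
  by (auto simp: spow_def abs_mult sgn_real_def)

lemma spow_0[simp]: "spow p 0 = 0"
  by (simp add: spow_def)

lemma borel_measurable_spow[measurable]: "spow p \<in> borel_measurable borel"
  unfolding spow_def[abs_def] by measurable

lemma borel_measurable_shrink[measurable]: "shrink k \<in> borel_measurable borel"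
  unfolding shrink_def[abs_def] by measurable

lemma diff_mult_spow_nonneg:
  assumes "0 < p" shows "0 \<le> (b - a) * (spow p b - spow p a)"
  using spow_mono[OF assms, of a b] spow_mono[OF assms, of b a]
  by (cases "a \<le> b") (auto simp: zero_le_mult_iff)

text \<open>The energy identity produces differences of the solution itself, the Nash inequality
  needs those of its soft threshold. Thresholding is monotone and 1-Lipschitz, so its increment has
  the sign of b - a and no larger modulus, and the second factor has that sign too.\<close>

lemma shrink_diff_mult_spow_le:
  assumes "0 < p" "0 \<le> k"
  shows "(shrink k b - shrink k a) * (spow p (shrink k b) - spow p (shrink k a))
    \<le> (b - a) * (spow p (shrink k b) - spow p (shrink k a))"
proof (cases "a \<le> b")
  case True
  then show ?thesis
    by (intro mult_right_mono) (auto simp: assms shrink_Lipschitz spow_mono shrink_mono)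
next
  case False
  then have "spow p (shrink k b) - spow p (shrink k a) \<le> 0" "b - a \<le> shrink k b - shrink k a"
    using shrink_Lipschitz[of k b a] by (auto simp: assms spow_mono shrink_mono)
  then show ?thesis by (intro mult_right_mono_neg)
qed

text \<open>Only the kink at 0 is delicate: there the difference quotient is at most |h|^(p-1),
  which tends to 0 because p > 1.\<close>

lemma has_real_derivative_pos_part_powr:
  assumes "1 < p"
  shows "((\<lambda>s::real. max s 0 powr p) has_real_derivative p * max s 0 powr (p - 1)) (at s)"
proof -
  consider "s > 0" | "s < 0" | "s = 0" by linarith
  then show ?thesis
  proof cases
    case 1
    have "((\<lambda>s. s powr p) has_real_derivative p * max s 0 powr (p - 1)) (at s)"
      using 1 by (auto intro!: derivative_eq_intros)
    moreover have "\<forall>\<^sub>F x in nhds s. x > 0" using 1 by (intro eventually_nhds_in_open[of "{0<..}", simplified]) auto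
    then have "\<forall>\<^sub>F x in nhds s. x powr p = max x 0 powr p" by eventually_elim auto
    ultimately show ?thesis by (subst (asm) DERIV_cong_ev[OF refl _ refl]) auto
  next
    case 2
    have "((\<lambda>s. 0) has_real_derivative p * max s 0 powr (p - 1)) (at s)"
      using 2 by auto
    moreover have "\<forall>\<^sub>F x in nhds s. x < 0" using 2 by (intro eventually_nhds_in_open[of "{..<0}", simplified]) auto
    then have "\<forall>\<^sub>F x in nhds s. 0 = max x 0 powr p" by eventually_elim auto
    ultimately show ?thesis by (subst (asm) DERIV_cong_ev[OF refl _ refl]) auto
  next
    case 3
    have "((\<lambda>h::real. \<bar>h\<bar> powr (p - 1)) \<longlongrightarrow> \<bar>0\<bar> powr (p - 1)) (at 0)"
      using assms by (intro tendsto_powr' tendsto_intros) auto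
    then have "((\<lambda>h::real. \<bar>h\<bar> powr (p - 1)) \<longlongrightarrow> 0) (at 0)" by simp
    then have "((\<lambda>h. max h 0 powr p / h) \<longlongrightarrow> 0) (at 0)"
    proof (rule Lim_null_comparison[rotated])
      have "norm (max h 0 powr p / h) \<le> \<bar>h\<bar> powr (p - 1)" for h :: real
      proof (cases "h > 0")
        case True
        then show ?thesis by (simp add: powr_diff)
      next
        case False
        then have "max h 0 = 0" by simp
        then show ?thesis by simp
      qed
      then show "\<forall>\<^sub>F h in at 0. norm (max h 0 powr p / h) \<le> \<bar>h\<bar> powr (p - 1)"
        by simp
    qed
    then show ?thesis unfolding 3 DERIV_def using assms by simp
  qed
qed

lemma has_real_derivative_shrink_powr:
  assumes "1 < p" "0 \<le> k"
  shows "((\<lambda>s. \<bar>shrink k s\<bar> powr p) has_real_derivative p * spow (p - 1) (shrink k s)) (at s)"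
proof -
  have *: "\<bar>shrink k s\<bar> powr p = max (s - k) 0 powr p + max (- s - k) 0 powr p" for s
    using assms by (auto simp: shrink_def max_def minus_diff_commute)
  have "((\<lambda>s. max (s - k) 0 powr p + max (- s - k) 0 powr p) has_real_derivative
      p * max (s - k) 0 powr (p - 1) * 1 + p * max (- s - k) 0 powr (p - 1) * (-1)) (at s)"
    by (intro DERIV_add DERIV_chain2[OF has_real_derivative_pos_part_powr[OF assms(1)]])
       (auto intro!: derivative_eq_intros)
  moreover have "p * max (s - k) 0 powr (p - 1) * 1 + p * max (- s - k) 0 powr (p - 1) * (-1)
      = p * spow (p - 1) (shrink k s)"
    using assms by (auto simp: shrink_def max_def spow_def sgn_real_def minus_diff_commute)
  ultimately show ?thesis unfolding * by simp
qed

text \<open>Either b is comparable to a, and the cross term suffices, or |b| < |a|/2, and then both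
  a - b and the difference of the signed powers keep a fixed fraction of a and of its signed power.
  The cross term is linear in b, so that it integrates to an L^1 norm.\<close>

lemma powr_le_diff_mult_spow:
  assumes "1 < p"
  shows "\<bar>a\<bar> powr p \<le> 2 / (1 - 2 powr (1 - p)) * ((b - a) * (spow (p - 1) b - spow (p - 1) a))
    + 2 * \<bar>a\<bar> powr (p - 1) * \<bar>b\<bar>"
proof -
  \<comment> \<open>The fraction of |a|^(p-1) that is left after subtracting (|a|/2)^(p-1); it is
    positive since p > 1.\<close>
  define c where "c = 1 - 2 powr (1 - p)"
  have "2 powr (1 - p) < 2 powr (0::real)" using assms by (intro powr_less_mono) auto
  then have c: "0 < c" by (simp add: c_def)
  have pw: "\<bar>a\<bar> powr p = \<bar>a\<bar> * \<bar>a\<bar> powr (p - 1)" by (cases "a = 0") (auto simp: powr_diff)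
  have D: "0 \<le> (b - a) * (spow (p - 1) b - spow (p - 1) a)"
    using assms by (intro diff_mult_spow_nonneg) auto
  show ?thesis
  proof (cases "\<bar>a\<bar> \<le> 2 * \<bar>b\<bar>")
    case True
    have "\<bar>a\<bar> powr p \<le> (2 * \<bar>b\<bar>) * \<bar>a\<bar> powr (p - 1)"
      unfolding pw using True by (intro mult_right_mono) auto
    moreover have "0 \<le> 2 / c * ((b - a) * (spow (p - 1) b - spow (p - 1) a))"
      using D c by simp
    ultimately show ?thesis unfolding c_def[symmetric] by (simp add: mult_ac)
  next
    case False
    have "\<bar>b\<bar> powr (p - 1) \<le> (\<bar>a\<bar> / 2) powr (p - 1)"
      using False assms by (intro powr_mono2) auto
    also have "\<dots> = \<bar>a\<bar> powr (p - 1) * 2 powr (1 - p)"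
      by (simp add: powr_divide powr_diff)
    finally have b: "\<bar>b\<bar> powr (p - 1) \<le> \<bar>a\<bar> powr (p - 1) * 2 powr (1 - p)" .
    have 1: "\<bar>a\<bar> / 2 \<le> \<bar>b - a\<bar>" using False by linarith
    have "\<bar>spow (p - 1) a\<bar> - \<bar>spow (p - 1) b\<bar> \<le> \<bar>spow (p - 1) b - spow (p - 1) a\<bar>" by linarith
    then have 2: "c * \<bar>a\<bar> powr (p - 1) \<le> \<bar>spow (p - 1) b - spow (p - 1) a\<bar>"
      using b by (simp add: abs_spow c_def algebra_simps)
    have "(\<bar>a\<bar> / 2) * (c * \<bar>a\<bar> powr (p - 1)) \<le> \<bar>b - a\<bar> * \<bar>spow (p - 1) b - spow (p - 1) a\<bar>"
      using 1 2 c by (intro mult_mono) auto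
    also have "\<dots> = (b - a) * (spow (p - 1) b - spow (p - 1) a)"
      using D by (simp add: abs_mult[symmetric])
    finally have "\<bar>a\<bar> powr p * c / 2 \<le> (b - a) * (spow (p - 1) b - spow (p - 1) a)"
      by (simp add: pw mult_ac)
    then have "\<bar>a\<bar> powr p \<le> 2 / c * ((b - a) * (spow (p - 1) b - spow (p - 1) a))"
      using c by (simp add: field_simps)
    moreover have "0 \<le> 2 * \<bar>a\<bar> powr (p - 1) * \<bar>b\<bar>" by simp
    ultimately show ?thesis unfolding c_def[symmetric] by linarith
  qed
qed

subsection \<open>A Nash-type inequality\<close>

text \<open>The kernel hypotheses in the form that the estimates consume: continuity becomes joint
  Borel measurability, boundedness an upper bound \<open>B\<close>. Fixing \<open>c1\<close> and
  \<open>c2\<close> here makes it visible that later constants depend on the kernel and not on the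
  data.\<close>

locale nonlocal_kernel =
  fixes J :: "'a::euclidean_space \<Rightarrow> 'a \<Rightarrow> real" and B c1 c2 \<sigma> :: real
  assumes J_nonneg: "0 \<le> J x y"
    and J_le: "J x y \<le> B"
    and J_measurable: "(\<lambda>(x, y). J x y) \<in> borel_measurable (borel \<Otimes>\<^sub>M borel)"
    and J_sym: "J x y = J y x"
    and J_integrable: "integrable lborel (J x)"
    and c1_pos: "0 < c1" and c2_pos: "0 < c2" and \<sigma>_pos: "0 < \<sigma>"
    and J_ge: "c2 < norm (x - y) \<Longrightarrow> c1 * norm (x - y) powr (- (real DIM('a) + 2 * \<sigma>)) \<le> J x y"
begin

text \<open>Formally, p/2 times this is the rate at which the integral of |w|^p decreases along the
  flow. For p > 1 the integrand is nonnegative, so values in \<open>ennreal\<close> avoid all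
  questions of integrability.\<close>

definition diss :: "real \<Rightarrow> ('a \<Rightarrow> real) \<Rightarrow> ennreal" where
  "diss p w = (\<integral>\<^sup>+x. \<integral>\<^sup>+y. ennreal (J x y * ((w y - w x) * (spow (p - 1) (w y) - spow (p - 1) (w x))))
     \<partial>lborel \<partial>lborel)"

lemma measurable_J[measurable (raw)]:
  assumes "f \<in> M \<rightarrow>\<^sub>M borel" "g \<in> M \<rightarrow>\<^sub>M borel"
  shows "(\<lambda>z. J (f z) (g z)) \<in> borel_measurable M"
  using measurable_compose[OF measurable_Pair[OF assms] J_measurable] by simp

lemma emeasure_annulus:
  fixes x :: 'a
  assumes "0 < \<rho>"
  shows "emeasure lborel (cball x (2 * \<rho>) - cball x \<rho>)
    = ennreal (unit_ball_vol DIM('a) * (2 ^ DIM('a) - 1) * \<rho> ^ DIM('a))"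
proof -
  have "emeasure lborel (cball x (2 * \<rho>) - cball x \<rho>)
      = emeasure lborel (cball x (2 * \<rho>)) - emeasure lborel (cball x \<rho>)"
    using assms by (intro emeasure_Diff) (auto simp: emeasure_cball)
  then show ?thesis using assms
    by (simp add: emeasure_cball ennreal_minus power_mult_distrib algebra_simps)
qed

text \<open>For fixed x the pointwise inequality is integrated over y in an annulus around x, which
  bounds m |w x|^p, with m the volume of the annulus, by dissipation plus a multiple of |w x|^(p-1)
  L. Large values of w absorb the last term into the left side; for small ones |w|^p is at most a
  constant times |w|, and the L^1 bound applies.\<close>

lemma nash_inequality:
  assumes p: "1 < p"
  shows "\<exists>C1>0. \<exists>C2>0. \<forall>w L \<rho>. w \<in> borel_measurable borel \<longrightarrow> 0 \<le> L \<longrightarrow>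
    (\<integral>\<^sup>+x. ennreal \<bar>w x\<bar> \<partial>lborel) \<le> ennreal L \<longrightarrow> c2 \<le> \<rho> \<longrightarrow>
    (\<integral>\<^sup>+x. ennreal (\<bar>w x\<bar> powr p) \<partial>lborel) \<le>
      ennreal (C1 * \<rho> powr (2 * \<sigma>)) * diss p w
      + ennreal (C2 * \<rho> powr (- (real DIM('a) * (p - 1))) * L powr p)"
proof -
  define n where "n = DIM('a)"
  define V where "V = unit_ball_vol n * (2 ^ n - 1)"
  have "(1::real) < 2 ^ n" unfolding n_def by (intro one_less_power) auto
  then have V: "0 < V" by (simp add: V_def)
  define K where "K = 2 / (1 - 2 powr (1 - p))"
  have "2 powr (1 - p) < 2 powr (0::real)" using p by (intro powr_less_mono) auto
  then have K: "0 < K" by (simp add: K_def)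
  define C1 where "C1 = 2 * K * 2 powr (n + 2 * \<sigma>) / (c1 * V)"
  define C2 where "C2 = (4 / V) powr (p - 1)"
  have C: "0 < C1" "0 < C2" using K V c1_pos by (simp_all add: C1_def C2_def)
  have "(\<integral>\<^sup>+x. ennreal (\<bar>w x\<bar> powr p) \<partial>lborel) \<le>
      ennreal (C1 * \<rho> powr (2 * \<sigma>)) * diss p w
      + ennreal (C2 * \<rho> powr (- (real DIM('a) * (p - 1))) * L powr p)"
    if w[measurable]: "w \<in> borel_measurable borel" and L: "0 \<le> L"
      and wL: "(\<integral>\<^sup>+x. ennreal \<bar>w x\<bar> \<partial>lborel) \<le> ennreal L" and \<rho>: "c2 \<le> \<rho>" for w L \<rho>
  proof -
    have \<rho>0: "0 < \<rho>" using \<rho> c2_pos by simp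
    define m where "m = V * \<rho> ^ n"
    have m: "0 < m" using V \<rho>0 by (simp add: m_def)
    \<comment> \<open>The lower bound for \<open>J\<close> at the outer radius of the annulus, hence
      on all of it.\<close>
    define j where "j = c1 * (2 * \<rho>) powr (- (real n + 2 * \<sigma>))"
    have j: "0 < j" using c1_pos \<rho>0 by (simp add: j_def)
    \<comment> \<open>The closed inner ball is removed so that distances exceed \<rho> \<ge>
      \<open>c2\<close> strictly, as \<open>J_ge\<close> demands.\<close>
    define A where "A = (\<lambda>x::'a. cball x (2 * \<rho>) - cball x \<rho>)"
    have [measurable]: "A x \<in> sets borel" for x by (simp add: A_def)
    have emA: "emeasure lborel (A x) = ennreal m" for x
      using emeasure_annulus[OF \<rho>0, of x] by (simp add: A_def m_def V_def n_def)
    define D where "D = (\<lambda>x y. J x y * ((w y - w x) * (spow (p - 1) (w y) - spow (p - 1) (w x))))"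
    have D[measurable]: "(\<lambda>(x, y). D x y) \<in> borel_measurable (borel \<Otimes>\<^sub>M borel)"
      unfolding D_def by measurable
    have D0: "0 \<le> D x y" for x y
      using p J_nonneg[of x y] unfolding D_def by (intro mult_nonneg_nonneg diff_mult_spow_nonneg) auto
    define F where "F = (\<lambda>x. \<integral>\<^sup>+y. ennreal (D x y) \<partial>lborel)"
    have [measurable]: "F \<in> borel_measurable borel" unfolding F_def by measurable
    have pt: "indicator (A x) y * \<bar>w x\<bar> powr p \<le> K / j * D x y + 2 * \<bar>w x\<bar> powr (p - 1) * \<bar>w y\<bar>" for x y
    proof (cases "y \<in> A x")
      case True
      then have d: "\<rho> < norm (x - y)" "norm (x - y) \<le> 2 * \<rho>" by (auto simp: A_def dist_norm)
      have "j \<le> c1 * norm (x - y) powr (- (real n + 2 * \<sigma>))"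
        unfolding j_def using c1_pos d \<rho>0 \<sigma>_pos
        by (intro mult_left_mono powr_mono2') auto
      also have "\<dots> \<le> J x y" unfolding n_def using d \<rho> by (intro J_ge) auto
      finally have "j * ((w y - w x) * (spow (p - 1) (w y) - spow (p - 1) (w x))) \<le> D x y"
        unfolding D_def using p by (intro mult_right_mono diff_mult_spow_nonneg) auto
      then have "(w y - w x) * (spow (p - 1) (w y) - spow (p - 1) (w x)) \<le> D x y / j"
        using j by (simp add: field_simps)
      then have "K * ((w y - w x) * (spow (p - 1) (w y) - spow (p - 1) (w x))) \<le> K * (D x y / j)"
        using K by (intro mult_left_mono) auto
      then show ?thesis using powr_le_diff_mult_spow[OF p, of "w x" "w y"] True
        unfolding K_def[symmetric] by simp
    qed (use D0[of x y] K j in auto)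
    have x1: "ennreal (m * \<bar>w x\<bar> powr p) \<le> ennreal (K / j) * F x + ennreal (2 * \<bar>w x\<bar> powr (p - 1) * L)" for x
    proof -
      have "ennreal (m * \<bar>w x\<bar> powr p) = (\<integral>\<^sup>+y. ennreal (\<bar>w x\<bar> powr p) * indicator (A x) y \<partial>lborel)"
        using m by (subst nn_integral_cmult_indicator) (auto simp: emA ennreal_mult' mult.commute)
      also have "\<dots> \<le> (\<integral>\<^sup>+y. ennreal (K / j) * ennreal (D x y) + ennreal (2 * \<bar>w x\<bar> powr (p - 1)) * ennreal \<bar>w y\<bar> \<partial>lborel)"
      proof (intro nn_integral_mono)
        fix y
        have "ennreal (\<bar>w x\<bar> powr p) * indicator (A x) y = ennreal (indicator (A x) y * \<bar>w x\<bar> powr p)"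
          by (simp split: split_indicator)
        also have "\<dots> \<le> ennreal (K / j * D x y + 2 * \<bar>w x\<bar> powr (p - 1) * \<bar>w y\<bar>)"
          by (intro ennreal_leI pt)
        also have "\<dots> = ennreal (K / j) * ennreal (D x y) + ennreal (2 * \<bar>w x\<bar> powr (p - 1)) * ennreal \<bar>w y\<bar>"
          using K j D0[of x y] by (simp add: ennreal_mult[symmetric] ennreal_plus[symmetric] del: ennreal_plus)
        finally show "ennreal (\<bar>w x\<bar> powr p) * indicator (A x) y \<le> \<dots>" .
      qed
      also have "\<dots> = ennreal (K / j) * F x + ennreal (2 * \<bar>w x\<bar> powr (p - 1)) * (\<integral>\<^sup>+y. ennreal \<bar>w y\<bar> \<partial>lborel)"
        unfolding F_def by (subst nn_integral_add) (auto simp: nn_integral_cmult)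
      also have "\<dots> \<le> ennreal (K / j) * F x + ennreal (2 * \<bar>w x\<bar> powr (p - 1)) * ennreal L"
        by (intro add_left_mono mult_left_mono wL) auto
      finally show ?thesis using L by (simp add: ennreal_mult')
    qed
    \<comment> \<open>The threshold 4L/m is chosen so that for |w x| above it the term 2 |w x|^(p-1)
      L is at most half of m |w x|^p. An infinite \<open>F x\<close> is treated apart: the right
      side is then infinite.\<close>
    have x2: "ennreal (\<bar>w x\<bar> powr p) \<le> ennreal (2 * K / (j * m)) * F x + ennreal ((4 * L / m) powr (p - 1)) * ennreal \<bar>w x\<bar>" for x
    proof (cases "F x")
      case (real r)
      define a where "a = \<bar>w x\<bar>"
      have a: "0 \<le> a" by (simp add: a_def)
      have ap: "a powr p = a * a powr (p - 1)" using a by (cases "a = 0") (auto simp: powr_diff)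
      have "ennreal (m * a powr p) \<le> ennreal (K / j * r + 2 * a powr (p - 1) * L)"
        using x1[of x] real K j L unfolding a_def[symmetric]
        by (simp add: ennreal_mult[symmetric] ennreal_plus[symmetric] del: ennreal_plus)
      then have *: "m * a powr p \<le> K / j * r + 2 * a powr (p - 1) * L"
        using K j L real by (subst (asm) ennreal_le_iff) auto
      have "a powr p \<le> 2 * K / (j * m) * r + (4 * L / m) powr (p - 1) * a"
      proof (cases "4 * L / m \<le> a")
        case True
        then have "4 * L \<le> m * a" using m by (simp add: field_simps)
        then have "a powr (p - 1) * (4 * L) \<le> a powr (p - 1) * (m * a)" by (intro mult_left_mono) auto
        then have "2 * a powr (p - 1) * L \<le> m * a powr p / 2" unfolding ap by (simp add: mult_ac)
        then have "m * a powr p \<le> 2 * (K / j * r)" using * by linarith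
        then have "a powr p \<le> 2 * K / (j * m) * r" using m j by (simp add: field_simps)
        moreover have "0 \<le> (4 * L / m) powr (p - 1) * a" using a by simp
        ultimately show ?thesis by linarith
      next
        case False
        then have "a powr (p - 1) \<le> (4 * L / m) powr (p - 1)" using a p by (intro powr_mono2) auto
        then have "a powr p \<le> (4 * L / m) powr (p - 1) * a" unfolding ap using a
          by (metis mult.commute mult_right_mono)
        moreover have "0 \<le> 2 * K / (j * m) * r" using K j m real by simp
        ultimately show ?thesis by linarith
      qed
      then have "ennreal (a powr p) \<le> ennreal (2 * K / (j * m) * r + (4 * L / m) powr (p - 1) * a)"
        by (intro ennreal_leI)
      also have "\<dots> = ennreal (2 * K / (j * m)) * F x + ennreal ((4 * L / m) powr (p - 1)) * ennreal a"
        unfolding real using K j m real(1) a by (simp only: ennreal_plus ennreal_mult' mult_nonneg_nonneg divide_nonneg_nonneg powr_ge_zero zero_le_numeral less_imp_le)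
      finally show ?thesis by (simp add: a_def)
    next
      case top
      have "0 < 2 * K / (j * m)" using K j m by simp
      then have "ennreal (2 * K / (j * m)) * F x = top"
        unfolding top by (subst ennreal_mult_top) (auto simp: ennreal_eq_0_iff)
      then show ?thesis by simp
    qed
    have "(\<integral>\<^sup>+x. ennreal (\<bar>w x\<bar> powr p) \<partial>lborel)
        \<le> (\<integral>\<^sup>+x. ennreal (2 * K / (j * m)) * F x + ennreal ((4 * L / m) powr (p - 1)) * ennreal \<bar>w x\<bar> \<partial>lborel)"
      by (intro nn_integral_mono x2)
    also have "\<dots> = ennreal (2 * K / (j * m)) * (\<integral>\<^sup>+x. F x \<partial>lborel)
        + ennreal ((4 * L / m) powr (p - 1)) * (\<integral>\<^sup>+x. ennreal \<bar>w x\<bar> \<partial>lborel)"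
      by (subst nn_integral_add) (auto simp: nn_integral_cmult)
    also have "\<dots> \<le> ennreal (2 * K / (j * m)) * diss p w + ennreal ((4 * L / m) powr (p - 1)) * ennreal L"
      unfolding diss_def F_def D_def by (intro add_left_mono mult_left_mono wL) auto
    also have "ennreal ((4 * L / m) powr (p - 1)) * ennreal L = ennreal ((4 * L / m) powr (p - 1) * L)"
      using L by (simp add: ennreal_mult')
    also have "(4 * L / m) powr (p - 1) * L = C2 * \<rho> powr (- (real n * (p - 1))) * L powr p"
    proof -
      have "L powr p = L powr (p - 1) * L" using L by (cases "L = 0") (auto simp: powr_diff)
      moreover have "(4 * L / m) powr (p - 1) = (4 / V) powr (p - 1) * L powr (p - 1) * \<rho> powr (- (real n * (p - 1)))"
      proof -
        have "4 * L / m = (4 / V) * L * \<rho> powr (- real n)"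
          using \<rho>0 by (simp add: m_def powr_minus powr_realpow divide_inverse)
        moreover have "(\<rho> powr (- real n)) powr (p - 1) = \<rho> powr (- (real n * (p - 1)))"
          by (simp add: powr_powr)
        ultimately show ?thesis by (simp only: powr_mult)
      qed
      ultimately show ?thesis by (simp add: C2_def)
    qed
    \<comment> \<open>The volume m carries \<rho>^n and 1/j carries \<rho>^(n + 2\<sigma>); the
      quotient leaves exactly \<rho>^(2\<sigma>).\<close>
    also have "2 * K / (j * m) = C1 * \<rho> powr (2 * \<sigma>)"
    proof -
      have "inverse j = (2 powr (n + 2 * \<sigma>) * (\<rho> powr n * \<rho> powr (2 * \<sigma>))) / c1"
        unfolding j_def using \<rho>0 by (simp only: powr_minus powr_mult powr_add[symmetric]) (simp add: divide_inverse)
      then have "2 * K / (j * m) = 2 * K * ((2 powr (n + 2 * \<sigma>) * (\<rho> ^ n * \<rho> powr (2 * \<sigma>))) / c1) / (V * \<rho> ^ n)"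
        using \<rho>0 by (simp add: m_def divide_inverse powr_realpow mult_ac)
      also have "\<dots> = C1 * \<rho> powr (2 * \<sigma>)"
        using \<rho>0 V c1_pos by (simp add: C1_def field_simps)
      finally show ?thesis .
    qed
    finally show ?thesis by (simp add: n_def)
  qed
  then show ?thesis using C by blast
qed

end

subsection \<open>Regular representatives of solutions\<close>

lemma Lp_norm_1: "Lp_norm 1 f = (\<integral>x. \<bar>f x\<bar> \<partial>lebesgue)"
  by (simp add: Lp_norm_def)

lemma Linf_norm_less_AE:
  assumes "Linf_norm f < ereal M"
  shows "AE x in lebesgue. \<bar>f x\<bar> \<le> M"
proof -
  have "AE x in lebesgue. ereal \<bar>f x\<bar> \<le> Linf_norm f"
    unfolding Linf_norm_def by (rule esssup_AE)
  then show ?thesis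
  proof eventually_elim
    case (elim x)
    then have "ereal \<bar>f x\<bar> < ereal M" using assms by (rule le_less_trans)
    then show ?case by simp
  qed
qed

lemma L1_Linf_bounded:
  assumes "f \<in> L1_Linf"
  obtains M where "AE x in lebesgue. \<bar>f x\<bar> \<le> M"
proof -
  obtain M where "Linf_norm f < ereal M"
  proof (cases "Linf_norm f")
    case (real r)
    then show ?thesis using that[of "r + 1"] by simp
  qed (use assms in \<open>auto simp: L1_Linf_def intro: that[of 0]\<close>)
  then show ?thesis using that Linf_norm_less_AE by blast
qed

lemma C_L1_Linf_locally_close:
  assumes u: "C_L1_Linf u" and t: "0 \<le> t" and e: "0 < e"
  shows "\<exists>d>0. \<forall>s\<ge>0. \<bar>s - t\<bar> < d \<longrightarrow>
    (AE x in lebesgue. \<bar>u s x - u t x\<bar> \<le> e) \<and> (\<integral>x. \<bar>u s x - u t x\<bar> \<partial>lebesgue) \<le> e"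
proof -
  have "\<forall>\<^sub>F s in at t within {0..}. Lp_norm 1 (\<lambda>x. u s x - u t x) < e"
    "\<forall>\<^sub>F s in at t within {0..}. Linf_norm (\<lambda>x. u s x - u t x) < ereal e"
    using u t e unfolding C_L1_Linf_def by (auto intro!: order_tendstoD(2)[of _ 0])
  then have "\<forall>\<^sub>F s in at t within {0..}. (AE x in lebesgue. \<bar>u s x - u t x\<bar> \<le> e) \<and>
    (\<integral>x. \<bar>u s x - u t x\<bar> \<partial>lebesgue) \<le> e"
    by eventually_elim (auto simp: Lp_norm_1 intro: Linf_norm_less_AE)
  then obtain d where "0 < d" "\<And>s. 0 \<le> s \<Longrightarrow> s \<noteq> t \<Longrightarrow> \<bar>s - t\<bar> < d \<Longrightarrow>
    (AE x in lebesgue. \<bar>u s x - u t x\<bar> \<le> e) \<and> (\<integral>x. \<bar>u s x - u t x\<bar> \<partial>lebesgue) \<le> e"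
    unfolding eventually_at by (auto simp: dist_real_def)
  moreover have "(AE x in lebesgue. \<bar>u t x - u t x\<bar> \<le> e) \<and> (\<integral>x. \<bar>u t x - u t x\<bar> \<partial>lebesgue) \<le> e"
    using e by simp
  ultimately show ?thesis by metis
qed

text \<open>Compactness of [0, T] in the form of bisection: near each t both norms exceed their
  values at t by at most 1.\<close>

lemma C_L1_Linf_bounded:
  assumes u: "C_L1_Linf u" and T: "0 \<le> T"
  shows "\<exists>M. \<forall>t\<in>{0..T}. (AE x in lebesgue. \<bar>u t x\<bar> \<le> M) \<and> (\<integral>x. \<bar>u t x\<bar> \<partial>lebesgue) \<le> M"
proof -
  have uL: "u t \<in> L1_Linf" if "0 \<le> t" for t using u that by (simp add: C_L1_Linf_def)
  \<comment> \<open>The clause \<open>0 \<le> t\<close> is there because the small intervals around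
    a point may reach below 0, where nothing is known about \<open>u\<close>.\<close>
  define P where "P = (\<lambda>a b. \<exists>M. \<forall>t\<in>{a..b}. 0 \<le> t \<longrightarrow>
    (AE x in lebesgue. \<bar>u t x\<bar> \<le> M) \<and> (\<integral>x. \<bar>u t x\<bar> \<partial>lebesgue) \<le> M)"
  have "P 0 T" using T
  proof (induction rule: Bolzano)
    case (trans a b c)
    then obtain M M' where
      M: "\<And>t. t\<in>{a..b} \<Longrightarrow> 0 \<le> t \<Longrightarrow> (AE x in lebesgue. \<bar>u t x\<bar> \<le> M) \<and> (\<integral>x. \<bar>u t x\<bar> \<partial>lebesgue) \<le> M"
      and M': "\<And>t. t\<in>{b..c} \<Longrightarrow> 0 \<le> t \<Longrightarrow> (AE x in lebesgue. \<bar>u t x\<bar> \<le> M') \<and> (\<integral>x. \<bar>u t x\<bar> \<partial>lebesgue) \<le> M'"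
      unfolding P_def by metis
    have "(AE x in lebesgue. \<bar>u t x\<bar> \<le> max M M') \<and> (\<integral>x. \<bar>u t x\<bar> \<partial>lebesgue) \<le> max M M'"
      if "t \<in> {a..c}" "0 \<le> t" for t
      using M[of t] M'[of t] that by (cases "t \<le> b") (auto simp: le_max_iff_disj)
    then show ?case unfolding P_def by blast
  next
    case (local t)
    obtain d where d: "0 < d" and close: "\<And>s. 0 \<le> s \<Longrightarrow> \<bar>s - t\<bar> < d \<Longrightarrow>
      (AE x in lebesgue. \<bar>u s x - u t x\<bar> \<le> 1) \<and> (\<integral>x. \<bar>u s x - u t x\<bar> \<partial>lebesgue) \<le> 1"
      using C_L1_Linf_locally_close[OF u local(1), of 1] by auto
    obtain M where M: "AE x in lebesgue. \<bar>u t x\<bar> \<le> M"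
      using L1_Linf_bounded uL[OF local(1)] by blast
    define M' where "M' = max (M + 1) ((\<integral>x. \<bar>u t x\<bar> \<partial>lebesgue) + 1)"
    have "(AE x in lebesgue. \<bar>u s x\<bar> \<le> M') \<and> (\<integral>x. \<bar>u s x\<bar> \<partial>lebesgue) \<le> M'"
      if s: "0 \<le> s" "\<bar>s - t\<bar> < d" for s
    proof
      have "AE x in lebesgue. \<bar>u s x - u t x\<bar> \<le> 1" using close[OF s] by blast
      then show "AE x in lebesgue. \<bar>u s x\<bar> \<le> M'" using M
        by eventually_elim (auto simp: M'_def)
      have int: "integrable lebesgue (u s)" "integrable lebesgue (u t)"
        using uL[OF s(1)] uL[OF local(1)] by (auto simp: L1_Linf_def)
      have "(\<integral>x. \<bar>u s x\<bar> \<partial>lebesgue) \<le> (\<integral>x. \<bar>u t x\<bar> + \<bar>u s x - u t x\<bar> \<partial>lebesgue)"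
        using int by (intro integral_mono) auto
      also have "\<dots> = (\<integral>x. \<bar>u t x\<bar> \<partial>lebesgue) + (\<integral>x. \<bar>u s x - u t x\<bar> \<partial>lebesgue)"
        using int by (intro Bochner_Integration.integral_add) auto
      also have "\<dots> \<le> M'" using close[OF s] by (auto simp: M'_def le_max_iff_disj)
      finally show "(\<integral>x. \<bar>u s x\<bar> \<partial>lebesgue) \<le> M'" .
    qed
    then have "P a b" if "a \<le> t" "t \<le> b" "b - a < d" for a b
      using that unfolding P_def by (intro exI[of _ M']) auto
    then show ?case using d by blast
  qed
  then show ?thesis unfolding P_def by auto
qed

text \<open>Continuity in time makes the function a pointwise limit of functions that are piecewise
  constant in time. Measurability is asked only at positive rational times, so that a representative
  need be controlled at countably many times.\<close>

lemma borel_measurable_continuous_in_time: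
  fixes v :: "real \<Rightarrow> 'a::euclidean_space \<Rightarrow> real"
  assumes r: "\<And>r. r \<in> \<rat> \<Longrightarrow> 0 < r \<Longrightarrow> v r \<in> borel_measurable borel"
    and c: "\<And>t x. 0 < t \<Longrightarrow> isCont (\<lambda>s. v s x) t"
  shows "(\<lambda>(t, x). indicator {0<..} t * v t x) \<in> borel_measurable (borel \<Otimes>\<^sub>M borel)"
proof -
  \<comment> \<open>The next point of the grid with mesh 1/(n+1) to the right of t. The added 1
    keeps it a positive rational even when the floor is 0.\<close>
  define r where "r = (\<lambda>n t. (of_int \<lfloor>real (Suc n) * t\<rfloor> + 1) / real (Suc n))"
  have meas: "(\<lambda>z. indicator {0<..} (fst z) * v (r n (fst z)) (snd z)) \<in> borel_measurable (borel \<Otimes>\<^sub>M borel)" for n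
  proof -
    define w where "w = (\<lambda>i x. if 0 \<le> i then v ((of_int i + 1) / real (Suc n)) x else 0)"
    have "w i \<in> borel_measurable borel" for i
      by (cases "0 \<le> i") (auto simp: w_def[abs_def] intro!: assms(1) divide_pos_pos)
    then have [measurable]: "(\<lambda>z. w i (snd z)) \<in> borel_measurable (borel \<Otimes>\<^sub>M (borel :: 'a measure))" for i
      by (rule measurable_compose[OF measurable_snd])
    have "(\<lambda>z. w \<lfloor>real (Suc n) * fst z\<rfloor> (snd z)) \<in> borel_measurable (borel \<Otimes>\<^sub>M (borel :: 'a measure))"
      by (rule measurable_compose_countable) measurable
    then have "(\<lambda>z. indicator {0<..} (fst z) * w \<lfloor>real (Suc n) * fst z\<rfloor> (snd z))
        \<in> borel_measurable (borel \<Otimes>\<^sub>M (borel :: 'a measure))"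
      by measurable
    also have "(\<lambda>z. indicator {0<..} (fst z) * w \<lfloor>real (Suc n) * fst z\<rfloor> (snd z))
        = (\<lambda>z. indicator {0<..} (fst z) * v (r n (fst z)) (snd z))"
      by (auto simp: fun_eq_iff r_def w_def split: split_indicator)
    finally show ?thesis .
  qed
  have lim: "(\<lambda>n. indicator {0<..} (fst z) * v (r n (fst z)) (snd z)) \<longlonglongrightarrow> indicator {0<..} (fst z) * v (fst z) (snd z)"
    for z :: "real \<times> 'a"
  proof (cases "0 < fst z")
    case True
    define t where "t = fst z"
    have "(\<lambda>n. r n t) \<longlonglongrightarrow> t"
    proof (rule tendsto_sandwich)
      have r: "t \<le> r n t" "r n t \<le> t + 1 / real (Suc n)" for n
      proof -
        define m where "m = real (Suc n)"
        have m: "0 < m" by (simp add: m_def)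
        have "of_int \<lfloor>m * t\<rfloor> \<le> m * t" "m * t \<le> of_int \<lfloor>m * t\<rfloor> + 1" by linarith+
        then show "t \<le> r n t" "r n t \<le> t + 1 / real (Suc n)"
          unfolding r_def m_def[symmetric] using m by (simp_all add: field_simps)
      qed
      show "\<forall>\<^sub>F n in sequentially. t \<le> r n t"
        "\<forall>\<^sub>F n in sequentially. r n t \<le> t + 1 / real (Suc n)"
        by (intro always_eventually allI r)+
      show "(\<lambda>n. t + 1 / real (Suc n)) \<longlonglongrightarrow> t"
        using tendsto_add[OF tendsto_const LIMSEQ_inverse_real_of_nat, of t] by (simp add: inverse_eq_divide)
    qed simp
    then have "(\<lambda>n. v (r n t) (snd z)) \<longlonglongrightarrow> v t (snd z)"
      using isCont_tendsto_compose[OF c[of t]] True by (simp add: t_def)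
    then show ?thesis using True by (simp add: t_def)
  qed simp
  show ?thesis
    unfolding case_prod_beta' by (rule borel_measurable_LIMSEQ_real[OF lim meas])
qed

text \<open>Setting \<open>u\<close> to 0 on a single null set of x yields joint measurability, a
  bound valid at every x and the equation in terms of \<open>lborel\<close>. Measurability and
  boundedness are secured at rational times, where countably many null sets can be united, and
  continuity in time carries them to all positive times.\<close>

lemma nonlocal_solution_representative:
  fixes u :: "real \<Rightarrow> 'a::euclidean_space \<Rightarrow> real"
  assumes sol: "nonlocal_solution J u0 u" and J[measurable]: "\<And>x. J x \<in> borel_measurable borel"
  obtains v where "(\<lambda>(t, x). v t x) \<in> borel_measurable (borel \<Otimes>\<^sub>M borel)"
    and "\<And>t. 0 < t \<Longrightarrow> AE x in lebesgue. v t x = u t x"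
    and "AE x in lborel. \<forall>t>0.
      ((\<lambda>s. v s x) has_real_derivative (\<integral>y. J x y * (v t y - v t x) \<partial>lborel)) (at t)"
    and "\<And>T. \<exists>M. \<forall>t x. 0 < t \<longrightarrow> t \<le> T \<longrightarrow> \<bar>v t x\<bar> \<le> M"
proof -
  have C: "C_L1_Linf u" using sol by (simp add: nonlocal_solution_def)
  have uL: "u t \<in> L1_Linf" if "0 \<le> t" for t using C that by (simp add: C_L1_Linf_def)
  then have um: "u t \<in> borel_measurable lebesgue" if "0 \<le> t" for t
    using that by (auto simp: L1_Linf_def dest: borel_measurable_integrable)
  then have "\<exists>w\<in>borel_measurable lborel. AE x in lborel. u t x = w x" if "0 \<le> t" for t
    using completion_ex_borel_measurable_real that by blast
  then have "\<forall>t. \<exists>w. 0 \<le> t \<longrightarrow> w \<in> borel_measurable lborel \<and> (AE x in lborel. u t x = w x)"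
    by blast
  from choice[OF this] obtain w where w: "\<And>t. 0 \<le> t \<Longrightarrow> w t \<in> borel_measurable lborel"
    and uw: "\<And>t. 0 \<le> t \<Longrightarrow> AE x in lborel. u t x = w t x"
    by blast
  \<comment> \<open>Natural numbers as end points, so that only countably many bounds have to hold
    simultaneously.\<close>
  have "\<forall>T. \<exists>M. \<forall>t\<in>{0..real T}. AE x in lebesgue. \<bar>u t x\<bar> \<le> M"
    using C_L1_Linf_bounded[OF C, of "real _"] by fastforce
  from choice[OF this] obtain M where "\<forall>T. \<forall>t\<in>{0..real T}. AE x in lebesgue. \<bar>u t x\<bar> \<le> M T"
    by blast
  then have M: "AE x in lebesgue. \<bar>u t x\<bar> \<le> M T" if "0 \<le> t" "t \<le> real T" for T t
    using that by auto
  have c: "countable {r \<in> \<rat>. (0::real) < r}" by (rule countable_subset[OF _ countable_rat]) auto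
  have "AE x in lborel. \<forall>r\<in>{r \<in> \<rat>. 0 < r}. u r x = w r x \<and> (\<forall>T. r \<le> real T \<longrightarrow> \<bar>u r x\<bar> \<le> M T)"
    unfolding AE_ball_countable[OF c] AE_conj_iff AE_all_countable
    using uw M by (auto simp: AE_completion_iff)
  moreover have "AE x in lborel. \<forall>t>0. ((\<lambda>s. u s x) has_real_derivative (\<integral>y. J x y * (u t y - u t x) \<partial>lebesgue)) (at t)"
    using sol by (simp add: nonlocal_solution_def AE_completion_iff)
  ultimately have "AE x in lborel. (\<forall>r\<in>{r \<in> \<rat>. 0 < r}. u r x = w r x \<and> (\<forall>T. r \<le> real T \<longrightarrow> \<bar>u r x\<bar> \<le> M T)) \<and>
      (\<forall>t>0. ((\<lambda>s. u s x) has_real_derivative (\<integral>y. J x y * (u t y - u t x) \<partial>lebesgue)) (at t))" (is "AE x in lborel. ?G x")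
    by (rule AE_conjI)
  then obtain N where N_ex: "\<And>x. x \<in> space lborel - N \<Longrightarrow> ?G x" and N: "N \<in> null_sets lborel"
    by (rule AE_E3) (rule that)
  have good: "?G x" if "x \<notin> N" for x
    by (rule N_ex) (simp add: that)
  from N have [measurable]: "N \<in> sets borel" by (simp add: null_setsD2[of N lborel, simplified])
  define v0 where "v0 = (\<lambda>t x. indicator (- N) x * u t x)"
  \<comment> \<open>The cut-off at t \<le> 0 gives joint measurability on the whole line; continuity
    in time is available only for t > 0.\<close>
  define v where "v = (\<lambda>t x. indicator {0<..} t * v0 t x)"
  have cont: "isCont (\<lambda>s. v0 s x) t" if "0 < t" for t x
  proof (cases "x \<in> N")
    case False
    then have "isCont (\<lambda>s. u s x) t" using good that DERIV_isCont by blast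
    then show ?thesis using False by (simp add: v0_def)
  qed (simp add: v0_def)
  have AEN: "AE x in lborel. x \<notin> N" using N by (rule AE_not_in)
  have meas: "(\<lambda>(t, x). v t x) \<in> borel_measurable (borel \<Otimes>\<^sub>M borel)"
    unfolding v_def
  proof (rule borel_measurable_continuous_in_time[OF _ cont])
    fix r :: real assume r: "r \<in> \<rat>" "0 < r"
    have [measurable]: "w r \<in> borel_measurable borel" using w[of r] r by simp
    have "v0 r = (\<lambda>x. indicator (- N) x * w r x)"
      using r good by (auto simp: v0_def fun_eq_iff split: split_indicator)
    then show "v0 r \<in> borel_measurable borel" by simp
  qed
  have vu: "AE x in lebesgue. v t x = u t x" if "0 < t" for t
    using AE_completion[OF AEN] by eventually_elim (use that in \<open>simp add: v_def v0_def\<close>)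
  have vm[measurable]: "v t \<in> borel_measurable borel" for t
    using measurable_compose[OF _ meas, of "\<lambda>x. (t, x)"] by simp
  have der: "AE x in lborel. \<forall>t>0. ((\<lambda>s. v s x) has_real_derivative (\<integral>y. J x y * (v t y - v t x) \<partial>lborel)) (at t)"
    using AEN
  proof eventually_elim
    case (elim x)
    show ?case
    proof (intro allI impI)
      fix t :: real assume t: "0 < t"
      have "(\<integral>y. J x y * (u t y - u t x) \<partial>lebesgue) = (\<integral>y. J x y * (v t y - v t x) \<partial>lebesgue)"
      proof (rule integral_cong_AE)
        have [measurable]: "u t \<in> borel_measurable lebesgue" using um t by simp
        have [measurable]: "J x \<in> borel_measurable lebesgue" "v t \<in> borel_measurable lebesgue"
          by (simp_all add: measurable_completion)
        show "(\<lambda>y. J x y * (u t y - u t x)) \<in> borel_measurable lebesgue"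
          "(\<lambda>y. J x y * (v t y - v t x)) \<in> borel_measurable lebesgue" by measurable
        show "AE y in lebesgue. J x y * (u t y - u t x) = J x y * (v t y - v t x)"
          using vu[OF t] by eventually_elim (use elim t in \<open>simp add: v_def v0_def\<close>)
      qed
      also have "\<dots> = (\<integral>y. J x y * (v t y - v t x) \<partial>lborel)"
        by (rule integral_completion) measurable
      finally have "((\<lambda>s. u s x) has_real_derivative (\<integral>y. J x y * (v t y - v t x) \<partial>lborel)) (at t)"
        using good[OF elim] t by auto
      moreover have "\<forall>\<^sub>F s in nhds t. u s x = v s x"
        using eventually_nhds_in_open[of "{0<..}" t] t by (auto simp: v_def v0_def elim elim!: eventually_mono)
      ultimately show "((\<lambda>s. v s x) has_real_derivative (\<integral>y. J x y * (v t y - v t x) \<partial>lborel)) (at t)"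
        by (subst (asm) DERIV_cong_ev[OF refl _ refl])
    qed
  qed
  have bdd: "\<exists>M. \<forall>t x. 0 < t \<longrightarrow> t \<le> T \<longrightarrow> \<bar>v t x\<bar> \<le> M" for T
  proof -
    obtain T' :: nat where T': "T < real T'" using reals_Archimedean2 by blast
    have "\<bar>v t x\<bar> \<le> max 0 (M T')" if t: "0 < t" "t \<le> T" for t x
    \<comment> \<open>A violation at t would persist by continuity at some rational time shortly
      after t. Since t \<le> T < \<open>real T'\<close>, that time can be taken below
      \<open>T'\<close>, where the bound holds off N.\<close>
    proof (rule ccontr)
      assume a: "\<not> \<bar>v t x\<bar> \<le> max 0 (M T')"
      then have x: "x \<notin> N" by (auto simp: v_def v0_def)
      have "isCont (\<lambda>s. \<bar>v0 s x\<bar>) t" by (intro continuous_intros cont t)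
      moreover have "v t x = v0 t x" using t by (simp add: v_def)
      with a have "max 0 (M T') < \<bar>v0 t x\<bar>" by (simp only: not_le)
      ultimately have "\<forall>\<^sub>F s in at t. max 0 (M T') < \<bar>v0 s x\<bar>"
        unfolding isCont_def by (rule order_tendstoD(1))
      then obtain d where d: "0 < d" "\<forall>s. s \<noteq> t \<and> \<bar>s - t\<bar> < d \<longrightarrow> max 0 (M T') < \<bar>v0 s x\<bar>"
        unfolding eventually_at dist_real_def by blast
      have "t < min (t + d) (real T')" using d(1) t T' by simp
      then obtain r where r: "r \<in> \<rat>" "t < r" "r < min (t + d) T'"
        using Rats_dense_in_real by blast
      then have "r \<in> {r \<in> \<rat>. 0 < r}" "r \<le> real T'" using t by auto
      then have "\<bar>u r x\<bar> \<le> M T'" using good[OF x] by blast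
      moreover have "max 0 (M T') < \<bar>v0 r x\<bar>" using d(2) r by simp
      moreover have "v0 r x = u r x" using x by (simp add: v0_def)
      ultimately show False by simp
    qed
    then show ?thesis by blast
  qed
  show ?thesis by (rule that[OF meas _ der bdd]) (rule vu)
qed

subsection \<open>Energy identity\<close>

context nonlocal_kernel
begin

text \<open>The chain rule for f (v t x) integrated in time at one fixed x. Positive and negative
  parts stand on opposite sides because the next step integrates over x, where either side may
  become infinite.\<close>

lemma energy_pointwise:
  fixes v :: "real \<Rightarrow> 'a \<Rightarrow> real"
  assumes t: "t0 \<le> t1"
    and v[measurable]: "(\<lambda>(t, x). v t x) \<in> borel_measurable (borel \<Otimes>\<^sub>M borel)"
    and vM: "\<And>t x. t0 \<le> t \<Longrightarrow> t \<le> t1 \<Longrightarrow> \<bar>v t x\<bar> \<le> M"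
    and vd: "\<And>t. t0 \<le> t \<Longrightarrow> t \<le> t1 \<Longrightarrow>
      ((\<lambda>s. v s x) has_real_derivative (\<integral>y. J x y * (v t y - v t x) \<partial>lborel)) (at t)"
    and f: "\<And>s. (f has_real_derivative \<phi> s) (at s)" and \<phi>: "mono \<phi>" and f0: "\<And>s. 0 \<le> f s"
  shows "ennreal (f (v t1 x))
      + (\<integral>\<^sup>+t. \<integral>\<^sup>+y. ennreal (- (indicator {t0..t1} t * (J x y * \<phi> (v t x) * (v t y - v t x)))) \<partial>lborel \<partial>lborel)
    = ennreal (f (v t0 x))
      + (\<integral>\<^sup>+t. \<integral>\<^sup>+y. ennreal (indicator {t0..t1} t * (J x y * \<phi> (v t x) * (v t y - v t x))) \<partial>lborel \<partial>lborel)"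
proof -
  note [measurable] = borel_measurable_mono[OF \<phi>]
  define g where "g = (\<lambda>(t, y). indicator {t0..t1} t * (J x y * \<phi> (v t x) * (v t y - v t x)))"
  have [measurable]: "g \<in> borel_measurable (lborel \<Otimes>\<^sub>M lborel)"
    unfolding g_def by measurable
  define c where "c = max \<bar>\<phi> M\<bar> \<bar>\<phi> (-M)\<bar> * (2 * M)"
  have c: "\<bar>\<phi> (v t x) * (v t y - v t x)\<bar> \<le> c" if "t0 \<le> t" "t \<le> t1" for t y
  proof -
    have "-M \<le> v t x" "v t x \<le> M" "\<bar>v t y\<bar> \<le> M" using vM[OF that, of x] vM[OF that, of y] by auto
    then have "\<phi> (-M) \<le> \<phi> (v t x)" "\<phi> (v t x) \<le> \<phi> M" "\<bar>v t y - v t x\<bar> \<le> 2 * M"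
      using monoD[OF \<phi>] by auto
    then show ?thesis unfolding c_def abs_mult by (intro mult_mono) auto
  qed
  have bnd: "\<bar>g (t, y)\<bar> \<le> indicator {t0..t1} t * (c * J x y)" for t y
    using mult_left_mono[OF c[of t y] J_nonneg[of x y]] J_nonneg[of x y]
    by (auto simp: g_def abs_mult mult_ac split: split_indicator)
  \<comment> \<open>At fixed x the kernel is integrable in y and the other factors are bounded by c,
    so Fubini applies even if the total rate is unbounded in x.\<close>
  have int: "integrable (lborel \<Otimes>\<^sub>M lborel) g"
  proof (rule Bochner_Integration.integrable_bound)
    have "(\<integral>\<^sup>+z. ennreal (norm (indicator {t0..t1} (fst z) * (c * J x (snd z)))) \<partial>(lborel \<Otimes>\<^sub>M lborel))
        = (\<integral>\<^sup>+t. \<integral>\<^sup>+y. indicator {t0..t1} t * ennreal (norm (c * J x y)) \<partial>lborel \<partial>lborel)"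
      by (subst lborel.nn_integral_fst[symmetric])
         (auto simp: abs_mult intro!: nn_integral_cong split: split_indicator)
    also have "\<dots> = (\<integral>\<^sup>+y. ennreal (norm (c * J x y)) \<partial>lborel) * emeasure lborel {t0..t1}"
      by (simp add: nn_integral_cmult nn_integral_multc mult.commute)
    also have "\<dots> < \<infinity>"
      using integrable_mult_right[OF J_integrable, of c x] t
      unfolding integrable_iff_bounded by (auto simp: ennreal_mult_less_top)
    finally show "integrable (lborel \<Otimes>\<^sub>M lborel) (\<lambda>z. indicator {t0..t1} (fst z) * (c * J x (snd z)))"
      by (intro integrableI_bounded) (auto simp del: real_norm_def)
    show "AE z in lborel \<Otimes>\<^sub>M lborel. norm (g z) \<le> norm (indicator {t0..t1} (fst z) * (c * J x (snd z)))"
      using bnd by (auto intro!: AE_I2 order_trans[OF bnd abs_ge_self])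
  qed measurable
  have inner: "(\<integral>y. g (t, y) \<partial>lborel) = indicator {t0..t1} t * (\<phi> (v t x) * (\<integral>y. J x y * (v t y - v t x) \<partial>lborel))" for t
    by (simp add: g_def integral_mult_right_zero[symmetric] mult_ac del: integral_mult_right_zero)
  \<comment> \<open>The derivative exists at every time of the interval, so the gauge integral
    returns the increment of f without continuity of the derivative. Lebesgue integrability, taken
    from \<open>int\<close>, then identifies the two integrals.\<close>
  have hi: "((\<lambda>t. \<phi> (v t x) * (\<integral>y. J x y * (v t y - v t x) \<partial>lborel)) has_integral f (v t1 x) - f (v t0 x)) {t0..t1}"
    using t
  proof (intro fundamental_theorem_of_calculus)
    fix t assume "t \<in> {t0..t1}"
    then have "((\<lambda>s. f (v s x)) has_real_derivative \<phi> (v t x) * (\<integral>y. J x y * (v t y - v t x) \<partial>lborel)) (at t)"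
      by (intro DERIV_chain2[OF f vd]) auto
    then show "((\<lambda>s. f (v s x)) has_vector_derivative \<phi> (v t x) * (\<integral>y. J x y * (v t y - v t x) \<partial>lborel)) (at t within {t0..t1})"
      by (auto intro!: has_field_derivative_at_within simp: has_real_derivative_iff_has_vector_derivative[symmetric])
  qed
  have "integrable lborel (\<lambda>t. \<integral>y. g (t, y) \<partial>lborel)"
    by (rule lborel_pair.integrable_fst'[OF int])
  then have si: "set_integrable lborel {t0..t1} (\<lambda>t. \<phi> (v t x) * (\<integral>y. J x y * (v t y - v t x) \<partial>lborel))"
    unfolding inner set_integrable_def by simp
  have "(LINT t:{t0..t1}|lborel. \<phi> (v t x) * (\<integral>y. J x y * (v t y - v t x) \<partial>lborel)) = f (v t1 x) - f (v t0 x)"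
    using set_borel_integral_eq_integral(2)[OF si] integral_unique[OF hi] by (rule trans)
  then have "(\<integral>t. \<integral>y. g (t, y) \<partial>lborel \<partial>lborel) = f (v t1 x) - f (v t0 x)"
    unfolding inner set_lebesgue_integral_def by simp
  then have eq: "integral\<^sup>L (lborel \<Otimes>\<^sub>M lborel) g = f (v t1 x) - f (v t0 x)"
    using lborel_pair.integral_fst'[OF int] by simp
  obtain P N where P: "0 \<le> P" "(\<integral>\<^sup>+z. ennreal (g z) \<partial>(lborel \<Otimes>\<^sub>M lborel)) = ennreal P"
    and N: "0 \<le> N" "(\<integral>\<^sup>+z. ennreal (- g z) \<partial>(lborel \<Otimes>\<^sub>M lborel)) = ennreal N"
    and PN: "integral\<^sup>L (lborel \<Otimes>\<^sub>M lborel) g = P - N"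
    by (rule integrableE[OF int]) (rule that)
  have "f (v t1 x) + N = f (v t0 x) + P" using eq PN by simp
  then have "ennreal (f (v t1 x)) + ennreal N = ennreal (f (v t0 x)) + ennreal P"
    using P N f0 by (simp add: ennreal_plus[symmetric] del: ennreal_plus)
  moreover have "(\<integral>\<^sup>+z. ennreal (g z) \<partial>(lborel \<Otimes>\<^sub>M lborel)) = (\<integral>\<^sup>+t. \<integral>\<^sup>+y. ennreal (g (t, y)) \<partial>lborel \<partial>lborel)"
    "(\<integral>\<^sup>+z. ennreal (- g z) \<partial>(lborel \<Otimes>\<^sub>M lborel)) = (\<integral>\<^sup>+t. \<integral>\<^sup>+y. ennreal (- g (t, y)) \<partial>lborel \<partial>lborel)"
    by (subst lborel.nn_integral_fst[symmetric]; simp)+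
  ultimately show ?thesis using P N unfolding g_def by simp
qed

text \<open>Symmetrizing in x and y turns \<phi> (v x) (v y - v x) into minus half the product of
  the two differences. The identity is doubled to avoid the factor 1/2, and every subtraction is
  postponed until the positive part P is known to be finite.\<close>

lemma energy_identity:
  fixes v :: "real \<Rightarrow> 'a \<Rightarrow> real"
  assumes t: "t0 \<le> t1"
    and v[measurable]: "(\<lambda>(t, x). v t x) \<in> borel_measurable (borel \<Otimes>\<^sub>M borel)"
    and vM: "\<And>t x. t0 \<le> t \<Longrightarrow> t \<le> t1 \<Longrightarrow> \<bar>v t x\<bar> \<le> M"
    and vL: "\<And>t. t0 \<le> t \<Longrightarrow> t \<le> t1 \<Longrightarrow> (\<integral>\<^sup>+x. ennreal \<bar>v t x\<bar> \<partial>lborel) \<le> ennreal L"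
    and vd: "AE x in lborel. \<forall>t\<in>{t0..t1}.
      ((\<lambda>s. v s x) has_real_derivative (\<integral>y. J x y * (v t y - v t x) \<partial>lborel)) (at t)"
    and f: "\<And>s. (f has_real_derivative \<phi> s) (at s)" and \<phi>: "mono \<phi>" and f0: "\<And>s. 0 \<le> f s"
    and k: "0 < k" and \<phi>0: "\<And>s. \<bar>s\<bar> \<le> k \<Longrightarrow> \<phi> s = 0"
  shows "2 * (\<integral>\<^sup>+x. ennreal (f (v t1 x)) \<partial>lborel)
      + (\<integral>\<^sup>+t. indicator {t0..t1} t *
          (\<integral>\<^sup>+x. \<integral>\<^sup>+y. ennreal (J x y * ((v t y - v t x) * (\<phi> (v t y) - \<phi> (v t x)))) \<partial>lborel \<partial>lborel) \<partial>lborel)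
    = 2 * (\<integral>\<^sup>+x. ennreal (f (v t0 x)) \<partial>lborel)"
proof -
  note [measurable] = borel_measurable_mono[OF \<phi>]
  have [measurable]: "f \<in> borel_measurable borel"
    by (intro borel_measurable_continuous_onI continuous_at_imp_continuous_on ballI DERIV_isCont[OF f])
  define g where "g = (\<lambda>t x y. indicator {t0..t1} t * (J x y * \<phi> (v t x) * (v t y - v t x)))"
  have vr[measurable (raw)]: "(\<lambda>z. v (a z) (b z)) \<in> borel_measurable Z"
    if "a \<in> Z \<rightarrow>\<^sub>M borel" "b \<in> Z \<rightarrow>\<^sub>M borel" for a b and Z :: "'z measure"
    using measurable_compose[OF measurable_Pair[OF that] v] by simp
  have gm[measurable (raw)]: "(\<lambda>z. g (a z) (b z) (c z)) \<in> borel_measurable Z"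
    if [measurable]: "a \<in> Z \<rightarrow>\<^sub>M borel" "b \<in> Z \<rightarrow>\<^sub>M borel" "c \<in> Z \<rightarrow>\<^sub>M borel" for a b c and Z :: "'z measure"
    unfolding g_def by measurable
  have swap: "(\<integral>\<^sup>+x. \<integral>\<^sup>+t. \<integral>\<^sup>+y. h t x y \<partial>lborel \<partial>lborel \<partial>lborel) = (\<integral>\<^sup>+t. \<integral>\<^sup>+x. \<integral>\<^sup>+y. h t x y \<partial>lborel \<partial>lborel \<partial>lborel)"
    if [measurable]: "(\<lambda>(t, x, y). h t x y) \<in> borel_measurable (lborel \<Otimes>\<^sub>M lborel \<Otimes>\<^sub>M lborel)"
    for h :: "real \<Rightarrow> 'a \<Rightarrow> 'a \<Rightarrow> ennreal"
  proof -
    have "(\<lambda>z. h (fst (fst z)) (snd (fst z)) (snd z)) \<in> borel_measurable ((lborel \<Otimes>\<^sub>M lborel) \<Otimes>\<^sub>M lborel)"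
      using measurable_compose[OF _ that, of "\<lambda>z. (fst (fst z), snd (fst z), snd z)"] by simp
    then show ?thesis
      by (intro lborel_pair.Fubini') (simp add: lborel.borel_measurable_nn_integral case_prod_beta')
  qed
  define P where "P = (\<integral>\<^sup>+t. \<integral>\<^sup>+x. \<integral>\<^sup>+y. ennreal (g t x y) \<partial>lborel \<partial>lborel \<partial>lborel)"
  define N where "N = (\<integral>\<^sup>+t. \<integral>\<^sup>+x. \<integral>\<^sup>+y. ennreal (- g t x y) \<partial>lborel \<partial>lborel \<partial>lborel)"
  define D where "D = (\<lambda>t x y. indicator {t0..t1} t * (J x y * ((v t y - v t x) * (\<phi> (v t y) - \<phi> (v t x)))))"
  have [measurable (raw)]: "(\<lambda>z. D (a z) (b z) (c z)) \<in> borel_measurable Z"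
    if [measurable]: "a \<in> Z \<rightarrow>\<^sub>M borel" "b \<in> Z \<rightarrow>\<^sub>M borel" "c \<in> Z \<rightarrow>\<^sub>M borel" for a b c and Z :: "'z measure"
    unfolding D_def by measurable
  have D0: "0 \<le> D t x y" for t x y
  proof -
    have "0 \<le> (v t y - v t x) * (\<phi> (v t y) - \<phi> (v t x))"
      using monoD[OF \<phi>, of "v t x" "v t y"] monoD[OF \<phi>, of "v t y" "v t x"]
      by (cases "v t x \<le> v t y") (auto simp: zero_le_mult_iff)
    then show ?thesis using J_nonneg[of x y] by (simp add: D_def split: split_indicator)
  qed
  have "AE x in lborel. ennreal (f (v t1 x)) + (\<integral>\<^sup>+t. \<integral>\<^sup>+y. ennreal (- g t x y) \<partial>lborel \<partial>lborel)
    = ennreal (f (v t0 x)) + (\<integral>\<^sup>+t. \<integral>\<^sup>+y. ennreal (g t x y) \<partial>lborel \<partial>lborel)"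
    using vd
  proof eventually_elim
    case (elim x)
    then show ?case unfolding g_def
      by (intro energy_pointwise[OF t v vM _ f \<phi> f0]) auto
  qed
  then have "(\<integral>\<^sup>+x. ennreal (f (v t1 x)) + (\<integral>\<^sup>+t. \<integral>\<^sup>+y. ennreal (- g t x y) \<partial>lborel \<partial>lborel) \<partial>lborel)
    = (\<integral>\<^sup>+x. ennreal (f (v t0 x)) + (\<integral>\<^sup>+t. \<integral>\<^sup>+y. ennreal (g t x y) \<partial>lborel \<partial>lborel) \<partial>lborel)"
    by (rule nn_integral_cong_AE)
  then have 1: "(\<integral>\<^sup>+x. ennreal (f (v t1 x)) \<partial>lborel) + N = (\<integral>\<^sup>+x. ennreal (f (v t0 x)) \<partial>lborel) + P"
    unfolding P_def N_def by (subst (asm) (1 2) nn_integral_add) (auto simp: swap)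
  have "P < \<infinity>"
  proof -
    define M' where "M' = max M 0"
    \<comment> \<open>Chosen so that c k^2 is the crude bound for the integrand; once |v x| and |v
      y| are at least k it passes to c |v x| |v y|, which is integrable over pairs by the L^1
      bound.\<close>
    define c where "c = B * (max (\<bar>\<phi> M'\<bar>) \<bar>\<phi> (- M')\<bar> * (2 * M')) / (k * k)"
    have B0: "0 \<le> B" using J_nonneg J_le order_trans by blast
    have M'0: "0 \<le> M'" by (simp add: M'_def)
    have c0: "0 \<le> c" using B0 k M'0 by (simp add: c_def)
    have gb: "g t x y \<le> indicator {t0..t1} t * (c * (\<bar>v t x\<bar> * \<bar>v t y\<bar>))" for t x y
    proof (cases "t \<in> {t0..t1} \<and> 0 < \<phi> (v t x) * (v t y - v t x)")
      case True
      then have vb: "\<bar>v t x\<bar> \<le> M'" "\<bar>v t y\<bar> \<le> M'" using vM[of t] by (auto simp: M'_def le_max_iff_disj)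
      have \<phi>s: "0 \<le> \<phi> s" if "0 \<le> s" for s using monoD[OF \<phi> that] \<phi>0[of 0] k by simp
      have \<phi>s': "\<phi> s \<le> 0" if "s \<le> 0" for s using monoD[OF \<phi> that] \<phi>0[of 0] k by simp
      \<comment> \<open>If \<phi> (v x) > 0 then v x > k, and positivity of the product puts v y
        above v x; the negative case mirrors this.\<close>
      have "k \<le> \<bar>v t x\<bar> \<and> k \<le> \<bar>v t y\<bar>"
      proof (cases "0 < \<phi> (v t x)")
        case p: True
        then have "0 < v t x" using \<phi>s'[of "v t x"] by linarith
        moreover have "k < \<bar>v t x\<bar>" using p \<phi>0[of "v t x"] by force
        moreover have "v t x < v t y" using True p by (simp add: zero_less_mult_iff)
        ultimately show ?thesis by linarith
      next
        case n: False
        then have "\<phi> (v t x) < 0" "v t y < v t x" using True by (auto simp: zero_less_mult_iff)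
        moreover then have "v t x < 0" using \<phi>s[of "v t x"] by linarith
        moreover have "k < \<bar>v t x\<bar>" using \<open>\<phi> (v t x) < 0\<close> \<phi>0[of "v t x"] by force
        ultimately show ?thesis by linarith
      qed
      then have kk: "k * k \<le> \<bar>v t x\<bar> * \<bar>v t y\<bar>" using k by (intro mult_mono) auto
      have "\<phi> (-M') \<le> \<phi> (v t x)" "\<phi> (v t x) \<le> \<phi> M'" using vb by (auto intro!: monoD[OF \<phi>])
      then have "\<bar>\<phi> (v t x) * (v t y - v t x)\<bar> \<le> max (\<bar>\<phi> M'\<bar>) \<bar>\<phi> (- M')\<bar> * (2 * M')"
        unfolding abs_mult using vb by (intro mult_mono) auto
      then have "J x y * (\<phi> (v t x) * (v t y - v t x)) \<le> B * (max (\<bar>\<phi> M'\<bar>) \<bar>\<phi> (- M')\<bar> * (2 * M'))"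
        using J_le[of x y] B0 True by (intro mult_mono[of "J x y"]) linarith+
      also have "\<dots> = c * (k * k)" using k by (simp add: c_def)
      also have "\<dots> \<le> c * (\<bar>v t x\<bar> * \<bar>v t y\<bar>)" using kk c0 by (intro mult_left_mono)
      finally show ?thesis using True by (simp add: g_def mult_ac)
    next
      case False
      then have "g t x y \<le> 0"
        using J_nonneg[of x y] by (auto simp: g_def mult.assoc mult_nonneg_nonpos split: split_indicator)
      also have "0 \<le> indicator {t0..t1} t * (c * (\<bar>v t x\<bar> * \<bar>v t y\<bar>))" using c0 by simp
      finally show ?thesis .
    qed
    have "(\<integral>\<^sup>+x. \<integral>\<^sup>+y. ennreal (g t x y) \<partial>lborel \<partial>lborel) \<le> ennreal (c * (L * L)) * indicator {t0..t1} t" for t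
    proof (cases "t \<in> {t0..t1}")
      case True
      have "(\<integral>\<^sup>+x. \<integral>\<^sup>+y. ennreal (g t x y) \<partial>lborel \<partial>lborel)
        \<le> (\<integral>\<^sup>+x. \<integral>\<^sup>+y. ennreal c * (ennreal \<bar>v t x\<bar> * ennreal \<bar>v t y\<bar>) \<partial>lborel \<partial>lborel)"
        using gb[of t] True c0 by (intro nn_integral_mono) (auto simp: ennreal_mult[symmetric] intro!: ennreal_leI)
      also have "\<dots> = ennreal c * ((\<integral>\<^sup>+x. ennreal \<bar>v t x\<bar> \<partial>lborel) * (\<integral>\<^sup>+x. ennreal \<bar>v t x\<bar> \<partial>lborel))"
        by (simp add: nn_integral_cmult nn_integral_multc)
      also have "\<dots> \<le> ennreal c * (ennreal L * ennreal L)"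
        using True by (intro mult_left_mono mult_mono vL) auto
      also have "\<dots> \<le> ennreal (c * (L * L))"
        using c0 by (cases "0 \<le> L") (auto simp: ennreal_mult ennreal_neg)
      finally show ?thesis using True by simp
    qed (simp add: g_def)
    then have "P \<le> (\<integral>\<^sup>+t. ennreal (c * (L * L)) * indicator {t0..t1} t \<partial>lborel)"
      unfolding P_def by (intro nn_integral_mono)
    also have "\<dots> < \<infinity>"
      using t by (subst nn_integral_cmult_indicator) (auto simp: ennreal_mult_less_top)
    finally show ?thesis .
  qed
  have sym: "(\<integral>\<^sup>+x. \<integral>\<^sup>+y. h x y \<partial>lborel \<partial>lborel) = (\<integral>\<^sup>+x. \<integral>\<^sup>+y. h y x \<partial>lborel \<partial>lborel)"
    if [measurable]: "(\<lambda>(x, y). h x y) \<in> borel_measurable (lborel \<Otimes>\<^sub>M lborel)"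
    for h :: "'a \<Rightarrow> 'a \<Rightarrow> ennreal"
    by (intro lborel_pair.Fubini') measurable
  \<comment> \<open>The algebraic identity g(x,y) + g(y,x) + D = 0, with each g split into its parts
    so that it survives integration in \<open>ennreal\<close>.\<close>
  have pt: "ennreal (g t x y) + ennreal (g t y x) + ennreal (D t x y) = ennreal (- g t x y) + ennreal (- g t y x)" for t x y
  proof -
    have e: "ennreal (max r 0) = ennreal r" for r by (simp add: max_def ennreal_neg)
    have "g t x y + g t y x + D t x y = 0"
      by (simp add: g_def D_def J_sym[of y x] algebra_simps split: split_indicator)
    then have "max (g t x y) 0 + max (g t y x) 0 + D t x y = max (- g t x y) 0 + max (- g t y x) 0"
      by (auto simp: max_def)
    then have "ennreal (max (g t x y) 0) + ennreal (max (g t y x) 0) + ennreal (D t x y)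
        = ennreal (max (- g t x y) 0) + ennreal (max (- g t y x) 0)"
      using D0[of t x y] by (simp add: ennreal_plus[symmetric] del: ennreal_plus)
    then show ?thesis by (simp only: e)
  qed
  have dbl: "(\<integral>\<^sup>+x. \<integral>\<^sup>+y. h x y + h y x \<partial>lborel \<partial>lborel) = 2 * (\<integral>\<^sup>+x. \<integral>\<^sup>+y. h x y \<partial>lborel \<partial>lborel)"
    if [measurable]: "(\<lambda>(x, y). h x y) \<in> borel_measurable (lborel \<Otimes>\<^sub>M lborel)"
    for h :: "'a \<Rightarrow> 'a \<Rightarrow> ennreal"
  proof -
    have "(\<integral>\<^sup>+x. \<integral>\<^sup>+y. h x y + h y x \<partial>lborel \<partial>lborel)
        = (\<integral>\<^sup>+x. \<integral>\<^sup>+y. h x y \<partial>lborel \<partial>lborel) + (\<integral>\<^sup>+x. \<integral>\<^sup>+y. h y x \<partial>lborel \<partial>lborel)"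
      by (simp add: nn_integral_add)
    then show ?thesis by (simp add: sym[of h, symmetric] mult_2)
  qed
  define E where "E = (\<integral>\<^sup>+t. \<integral>\<^sup>+x. \<integral>\<^sup>+y. ennreal (D t x y) \<partial>lborel \<partial>lborel \<partial>lborel)"
  have "2 * (\<integral>\<^sup>+x. \<integral>\<^sup>+y. ennreal (g t x y) \<partial>lborel \<partial>lborel) + (\<integral>\<^sup>+x. \<integral>\<^sup>+y. ennreal (D t x y) \<partial>lborel \<partial>lborel)
    = 2 * (\<integral>\<^sup>+x. \<integral>\<^sup>+y. ennreal (- g t x y) \<partial>lborel \<partial>lborel)" for t
  proof -
    have "(\<integral>\<^sup>+x. \<integral>\<^sup>+y. (ennreal (g t x y) + ennreal (g t y x)) + ennreal (D t x y) \<partial>lborel \<partial>lborel)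
      = (\<integral>\<^sup>+x. \<integral>\<^sup>+y. ennreal (- g t x y) + ennreal (- g t y x) \<partial>lborel \<partial>lborel)"
      by (simp add: pt)
    moreover have "(\<integral>\<^sup>+x. \<integral>\<^sup>+y. (ennreal (g t x y) + ennreal (g t y x)) + ennreal (D t x y) \<partial>lborel \<partial>lborel)
      = (\<integral>\<^sup>+x. \<integral>\<^sup>+y. ennreal (g t x y) + ennreal (g t y x) \<partial>lborel \<partial>lborel) + (\<integral>\<^sup>+x. \<integral>\<^sup>+y. ennreal (D t x y) \<partial>lborel \<partial>lborel)"
      by (subst nn_integral_add, simp, simp) (subst nn_integral_add, auto)
    ultimately show ?thesis
      by (simp add: dbl[of "\<lambda>x y. ennreal (g t x y)"] dbl[of "\<lambda>x y. ennreal (- g t x y)"])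
  qed
  then have "(\<integral>\<^sup>+t. 2 * (\<integral>\<^sup>+x. \<integral>\<^sup>+y. ennreal (g t x y) \<partial>lborel \<partial>lborel) + (\<integral>\<^sup>+x. \<integral>\<^sup>+y. ennreal (D t x y) \<partial>lborel \<partial>lborel) \<partial>lborel)
    = (\<integral>\<^sup>+t. 2 * (\<integral>\<^sup>+x. \<integral>\<^sup>+y. ennreal (- g t x y) \<partial>lborel \<partial>lborel) \<partial>lborel)"
    by simp
  then have 2: "2 * P + E = 2 * N"
    unfolding P_def E_def N_def by (subst (asm) nn_integral_add) (auto simp: nn_integral_cmult)
  \<comment> \<open>\<open>2 * P\<close> is added to both sides and cancelled afterwards, which its
    finiteness permits; the energies themselves may be infinite.\<close>
  have "2 * (\<integral>\<^sup>+x. ennreal (f (v t1 x)) \<partial>lborel) + E + 2 * P = 2 * ((\<integral>\<^sup>+x. ennreal (f (v t1 x)) \<partial>lborel) + N)"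
    unfolding distrib_left 2[symmetric] by (simp add: ac_simps)
  also have "\<dots> = 2 * (\<integral>\<^sup>+x. ennreal (f (v t0 x)) \<partial>lborel) + 2 * P"
    by (simp add: 1 distrib_left)
  finally have "2 * (\<integral>\<^sup>+x. ennreal (f (v t1 x)) \<partial>lborel) + E = 2 * (\<integral>\<^sup>+x. ennreal (f (v t0 x)) \<partial>lborel)"
    using \<open>P < \<infinity>\<close> ennreal_add_left_cancel[of "2 * P"]
    by (auto simp: ennreal_mult_eq_top_iff ac_simps)
  moreover have "E = (\<integral>\<^sup>+t. indicator {t0..t1} t *
          (\<integral>\<^sup>+x. \<integral>\<^sup>+y. ennreal (J x y * ((v t y - v t x) * (\<phi> (v t y) - \<phi> (v t x)))) \<partial>lborel \<partial>lborel) \<partial>lborel)"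
    unfolding E_def D_def by (intro nn_integral_cong) (simp split: split_indicator)
  ultimately show ?thesis by simp
qed

end

subsection \<open>Decay of the norms\<close>

lemma integrable_powr_if_bounded:
  fixes f :: "'a \<Rightarrow> real"
  assumes f: "integrable M f" and C: "AE x in M. \<bar>f x\<bar> \<le> C" and p: "1 \<le> p"
  shows "integrable M (\<lambda>x. \<bar>f x\<bar> powr p)"
proof (rule Bochner_Integration.integrable_bound)
  show "integrable M (\<lambda>x. C powr (p - 1) * \<bar>f x\<bar>)" using f by simp
  have [measurable]: "f \<in> borel_measurable M" using f by (rule borel_measurable_integrable)
  show "(\<lambda>x. \<bar>f x\<bar> powr p) \<in> borel_measurable M" by measurable
  show "AE x in M. norm (\<bar>f x\<bar> powr p) \<le> norm (C powr (p - 1) * \<bar>f x\<bar>)"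
    using C
  proof eventually_elim
    case (elim x)
    then have "\<bar>f x\<bar> powr (p - 1) \<le> C powr (p - 1)" using p by (intro powr_mono2) auto
    then have "\<bar>f x\<bar> powr (p - 1) * \<bar>f x\<bar> \<le> C powr (p - 1) * \<bar>f x\<bar>" by (intro mult_right_mono) auto
    moreover have "\<bar>f x\<bar> powr p = \<bar>f x\<bar> powr (p - 1) * \<bar>f x\<bar>"
      by (cases "f x = 0") (auto simp: powr_diff)
    ultimately show ?case by simp
  qed
qed

text \<open>A Borel representative at positive times. The initial datum enters through uniform
  closeness for small t, which is what a soft threshold can absorb; \<open>v_L1\<close> is a crude
  local bound that feeds the energy identity, from which the sharp L^1 bound follows.\<close>

locale regular_solution = nonlocal_kernel +
  fixes u0 :: "'a \<Rightarrow> real" and v :: "real \<Rightarrow> 'a \<Rightarrow> real"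
  assumes v_measurable: "(\<lambda>(t, x). v t x) \<in> borel_measurable (borel \<Otimes>\<^sub>M borel)"
    and v_deriv: "AE x in lborel. \<forall>t>0.
      ((\<lambda>s. v s x) has_real_derivative (\<integral>y. J x y * (v t y - v t x) \<partial>lborel)) (at t)"
    and v_bounded: "\<exists>M. \<forall>t x. 0 < t \<longrightarrow> t \<le> T \<longrightarrow> \<bar>v t x\<bar> \<le> M"
    and v_L1: "\<exists>L. \<forall>t. 0 < t \<longrightarrow> t \<le> T \<longrightarrow> (\<integral>\<^sup>+x. ennreal \<bar>v t x\<bar> \<partial>lborel) \<le> ennreal L"
    and v_initial: "0 < e \<Longrightarrow> \<exists>d>0. \<forall>t. 0 < t \<longrightarrow> t < d \<longrightarrow> (AE x in lborel. \<bar>v t x - u0 x\<bar> \<le> e)"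
    and u0_integrable: "integrable lborel u0"
    and u0_bounded: "\<exists>M. AE x in lborel. \<bar>u0 x\<bar> \<le> M"
begin

lemma v_measurable_section[measurable]: "v t \<in> borel_measurable borel"
  using measurable_compose[OF _ v_measurable, of "\<lambda>x. (t, x)"] by simp

lemma u0_powr_integrable: "1 \<le> p \<Longrightarrow> integrable lborel (\<lambda>x. \<bar>u0 x\<bar> powr p)"
  using u0_bounded integrable_powr_if_bounded[OF u0_integrable] by blast

lemma u0_measurable[measurable]: "u0 \<in> borel_measurable borel"
  using borel_measurable_integrable[OF u0_integrable] by simp

definition shrunk_energy :: "real \<Rightarrow> real \<Rightarrow> real \<Rightarrow> ennreal" where
  "shrunk_energy p k t = (\<integral>\<^sup>+x. ennreal (\<bar>shrink k (v t x)\<bar> powr p) \<partial>lborel)"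

text \<open>The energy identity with f = |\<open>shrink k\<close>|^p. It becomes an inequality
  because the factor p > 1 is lowered to 1 and differences of v are replaced by those of its soft
  threshold.\<close>

lemma shrunk_energy_dissipation:
  assumes p: "1 < p" and k: "0 < k" and t: "0 < t0" "t0 \<le> t1"
  shows "2 * shrunk_energy p k t1
      + (\<integral>\<^sup>+t. indicator {t0..t1} t * diss p (\<lambda>x. shrink k (v t x)) \<partial>lborel)
    \<le> 2 * shrunk_energy p k t0"
proof -
  obtain M where M: "\<forall>t x. 0 < t \<longrightarrow> t \<le> t1 \<longrightarrow> \<bar>v t x\<bar> \<le> M" using v_bounded by blast
  obtain L where L: "\<forall>t. 0 < t \<longrightarrow> t \<le> t1 \<longrightarrow> (\<integral>\<^sup>+x. ennreal \<bar>v t x\<bar> \<partial>lborel) \<le> ennreal L" using v_L1 by blast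
  define \<phi> where "\<phi> = (\<lambda>s. p * spow (p - 1) (shrink k s))"
  have "mono \<phi>" unfolding \<phi>_def using p
    by (intro monoI mult_left_mono spow_mono shrink_mono) auto
  have "2 * (\<integral>\<^sup>+x. ennreal (\<bar>shrink k (v t1 x)\<bar> powr p) \<partial>lborel)
      + (\<integral>\<^sup>+t. indicator {t0..t1} t *
          (\<integral>\<^sup>+x. \<integral>\<^sup>+y. ennreal (J x y * ((v t y - v t x) * (\<phi> (v t y) - \<phi> (v t x)))) \<partial>lborel \<partial>lborel) \<partial>lborel)
    = 2 * (\<integral>\<^sup>+x. ennreal (\<bar>shrink k (v t0 x)\<bar> powr p) \<partial>lborel)"
  proof (rule energy_identity[OF t(2) v_measurable _ _ _ _ \<open>mono \<phi>\<close> _ k])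
    show "\<bar>v t x\<bar> \<le> M" if "t0 \<le> t" "t \<le> t1" for t x using M that t by simp
    show "(\<integral>\<^sup>+x. ennreal \<bar>v t x\<bar> \<partial>lborel) \<le> ennreal L" if "t0 \<le> t" "t \<le> t1" for t using L that t by simp
    show "AE x in lborel. \<forall>t\<in>{t0..t1}.
      ((\<lambda>s. v s x) has_real_derivative (\<integral>y. J x y * (v t y - v t x) \<partial>lborel)) (at t)"
      using v_deriv by eventually_elim (use t in simp)
    show "((\<lambda>s. \<bar>shrink k s\<bar> powr p) has_real_derivative \<phi> s) (at s)" for s
      unfolding \<phi>_def using p k by (intro has_real_derivative_shrink_powr) auto
    show "\<phi> s = 0" if "\<bar>s\<bar> \<le> k" for s using shrink_eq_0[OF that] by (simp add: \<phi>_def)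
  qed simp
  moreover have "(\<integral>\<^sup>+t. indicator {t0..t1} t * diss p (\<lambda>x. shrink k (v t x)) \<partial>lborel)
    \<le> (\<integral>\<^sup>+t. indicator {t0..t1} t *
          (\<integral>\<^sup>+x. \<integral>\<^sup>+y. ennreal (J x y * ((v t y - v t x) * (\<phi> (v t y) - \<phi> (v t x)))) \<partial>lborel \<partial>lborel) \<partial>lborel)"
    unfolding diss_def
  proof (intro nn_integral_mono mult_left_mono ennreal_leI J_nonneg)
    fix t x y
    define S where "S = spow (p - 1) (shrink k (v t y)) - spow (p - 1) (shrink k (v t x))"
    have 1: "(shrink k (v t y) - shrink k (v t x)) * S \<le> (v t y - v t x) * S"
      unfolding S_def using p k by (intro shrink_diff_mult_spow_le) auto
    have "0 \<le> (shrink k (v t y) - shrink k (v t x)) * S"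
      unfolding S_def using p by (intro diff_mult_spow_nonneg) auto
    then have "1 * ((v t y - v t x) * S) \<le> p * ((v t y - v t x) * S)"
      using 1 p by (intro mult_right_mono) auto
    then have "(shrink k (v t y) - shrink k (v t x)) * S \<le> p * ((v t y - v t x) * S)"
      using 1 by simp
    also have "\<dots> = (v t y - v t x) * (\<phi> (v t y) - \<phi> (v t x))"
      by (simp add: \<phi>_def S_def algebra_simps)
    finally show "(shrink k (v t y) - shrink k (v t x)) *
        (spow (p - 1) (shrink k (v t y)) - spow (p - 1) (shrink k (v t x)))
      \<le> (v t y - v t x) * (\<phi> (v t y) - \<phi> (v t x))"
      unfolding S_def .
  qed simp
  ultimately show ?thesis unfolding shrunk_energy_def
    by (metis (no_types, lifting) add_left_mono)
qed

lemma shrunk_energy_antimono: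
  assumes p: "1 < p" and k: "0 < k" and t: "0 < t0" "t0 \<le> t1"
  shows "shrunk_energy p k t1 \<le> shrunk_energy p k t0"
proof -
  have "2 * shrunk_energy p k t1 \<le> 2 * shrunk_energy p k t1
      + (\<integral>\<^sup>+t. indicator {t0..t1} t * diss p (\<lambda>x. shrink k (v t x)) \<partial>lborel)"
    by simp
  also have "\<dots> \<le> 2 * shrunk_energy p k t0" by (rule shrunk_energy_dissipation[OF assms])
  finally show ?thesis by (subst (asm) ennreal_mult_le_mult_iff) auto
qed

text \<open>The soft threshold absorbs the uniform distance between \<open>v s\<close> and \<open>u0\<close> for small \<open>s\<close>,
  so no convergence of the norms at time \<open>0\<close> is needed.\<close>

lemma shrunk_energy_le_initial:
  assumes p: "1 < p" and k: "0 < k" and t: "0 < t"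
  shows "shrunk_energy p k t \<le> (\<integral>\<^sup>+x. ennreal (\<bar>u0 x\<bar> powr p) \<partial>lborel)"
proof -
  obtain d where d: "0 < d" "\<forall>t. 0 < t \<longrightarrow> t < d \<longrightarrow> (AE x in lborel. \<bar>v t x - u0 x\<bar> \<le> k)"
    using v_initial[OF k] by blast
  define s where "s = min t (d / 2)"
  have s: "0 < s" "s \<le> t" "s < d" using t d(1) by (auto simp: s_def)
  have "AE x in lborel. \<bar>v s x - u0 x\<bar> \<le> k" using d s by blast
  then have "shrunk_energy p k s \<le> (\<integral>\<^sup>+x. ennreal (\<bar>u0 x\<bar> powr p) \<partial>lborel)"
    unfolding shrunk_energy_def
  proof (intro nn_integral_mono_AE, eventually_elim)
    case (elim x)
    then have "\<bar>shrink k (v s x)\<bar> \<le> \<bar>u0 x\<bar>" using k by (simp add: abs_shrink)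
    then show ?case using p by (intro ennreal_leI powr_mono2) auto
  qed
  then show ?thesis using shrunk_energy_antimono[OF p k s(1,2)] by (rule order_trans[rotated])
qed

text \<open>Fatou's lemma. The exponent varies together with the threshold so that exponent 1 can be
  approached from above.\<close>

lemma nn_integral_liminf_shrink:
  fixes p k :: "nat \<Rightarrow> real"
  assumes "k \<longlonglongrightarrow> 0" "\<And>n. 0 < k n" "p \<longlonglongrightarrow> p0" "0 < p0"
  shows "(\<integral>\<^sup>+x. ennreal (\<bar>v t x\<bar> powr p0) \<partial>lborel) \<le> liminf (\<lambda>n. shrunk_energy (p n) (k n) t)"
proof -
  have "(\<lambda>n. ennreal (\<bar>shrink (k n) s\<bar> powr p n)) \<longlonglongrightarrow> ennreal (\<bar>s\<bar> powr p0)" for s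
  proof (cases "s = 0")
    case True
    then show ?thesis using assms(2) by (simp add: shrink_eq_0 less_imp_le)
  next
    case False
    have "(\<lambda>n. max (\<bar>s\<bar> - k n) 0) \<longlonglongrightarrow> max (\<bar>s\<bar> - 0) 0"
      by (intro tendsto_intros assms)
    then have "(\<lambda>n. \<bar>shrink (k n) s\<bar>) \<longlonglongrightarrow> \<bar>s\<bar>"
      using assms(2) by (simp add: abs_shrink less_imp_le)
    then show ?thesis using False assms by (intro tendsto_ennrealI tendsto_powr) auto
  qed
  then have "(\<integral>\<^sup>+x. ennreal (\<bar>v t x\<bar> powr p0) \<partial>lborel)
      = (\<integral>\<^sup>+x. liminf (\<lambda>n. ennreal (\<bar>shrink (k n) (v t x)\<bar> powr p n)) \<partial>lborel)"
    by (intro nn_integral_cong sym[OF lim_imp_Liminf]) auto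
  also have "\<dots> \<le> liminf (\<lambda>n. shrunk_energy (p n) (k n) t)"
    unfolding shrunk_energy_def by (intro nn_integral_liminf) measurable
  finally show ?thesis .
qed

lemma nn_integral_powr_le_if_shrunk:
  assumes "\<And>k. 0 < k \<Longrightarrow> shrunk_energy p k t \<le> c" and p: "0 < p"
  shows "(\<integral>\<^sup>+x. ennreal (\<bar>v t x\<bar> powr p) \<partial>lborel) \<le> c"
proof -
  have "(\<integral>\<^sup>+x. ennreal (\<bar>v t x\<bar> powr p) \<partial>lborel) \<le> liminf (\<lambda>n. shrunk_energy p (1 / real (Suc n)) t)"
    using p LIMSEQ_inverse_real_of_nat by (intro nn_integral_liminf_shrink) (auto simp: inverse_eq_divide)
  also have "\<dots> \<le> liminf (\<lambda>n. c)"
    by (intro Liminf_mono always_eventually allI assms) simp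
  finally show ?thesis by (simp add: Liminf_const)
qed

text \<open>The case \<open>p = 1\<close> is not covered by the energy estimate; it is the limit \<open>p \<rightarrow> 1\<close>.\<close>

lemma L1_contraction:
  assumes t: "0 < t"
  shows "(\<integral>\<^sup>+x. ennreal \<bar>v t x\<bar> \<partial>lborel) \<le> ennreal (\<integral>x. \<bar>u0 x\<bar> \<partial>lborel)"
proof -
  define L where "L = (\<integral>x. \<bar>u0 x\<bar> \<partial>lborel)"
  have L0: "0 \<le> L" by (simp add: L_def)
  have L: "(\<integral>\<^sup>+x. ennreal \<bar>u0 x\<bar> \<partial>lborel) = ennreal L"
    unfolding L_def using u0_integrable by (intro nn_integral_eq_integral) auto
  obtain M where M: "AE x in lborel. \<bar>u0 x\<bar> \<le> M" using u0_bounded by blast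
  \<comment> \<open>Interpolating with the sup bound gives |u0|^(1+h) \<le> m^h |u0|. Raising the
    bound to at least 1 ensures that m^h tends to 1.\<close>
  define m where "m = max M 1"
  have m: "1 \<le> m" by (simp add: m_def)
  define h where "h = (\<lambda>n. 1 / real (Suc n))"
  have h: "h \<longlonglongrightarrow> 0" "\<And>n. 0 < h n"
    using LIMSEQ_inverse_real_of_nat by (auto simp: h_def inverse_eq_divide)
  have le: "shrunk_energy (1 + h n) (h n) t \<le> ennreal (m powr h n * L)" for n
  proof -
    have "shrunk_energy (1 + h n) (h n) t \<le> (\<integral>\<^sup>+x. ennreal (\<bar>u0 x\<bar> powr (1 + h n)) \<partial>lborel)"
      using h(2)[of n] t by (intro shrunk_energy_le_initial) auto
    also have "\<dots> \<le> (\<integral>\<^sup>+x. ennreal (m powr h n) * ennreal \<bar>u0 x\<bar> \<partial>lborel)"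
    proof (intro nn_integral_mono_AE, use M in eventually_elim)
      case (elim x)
      then have "\<bar>u0 x\<bar> powr h n \<le> m powr h n" using h(2)[of n] by (intro powr_mono2) (auto simp: m_def)
      then have "\<bar>u0 x\<bar> powr h n * \<bar>u0 x\<bar> \<le> m powr h n * \<bar>u0 x\<bar>" by (intro mult_right_mono) auto
      moreover have "\<bar>u0 x\<bar> powr (1 + h n) = \<bar>u0 x\<bar> powr h n * \<bar>u0 x\<bar>"
        by (simp add: powr_add)
      ultimately show ?case by (simp add: ennreal_mult[symmetric] ennreal_leI)
    qed
    also have "\<dots> = ennreal (m powr h n * L)"
      by (simp add: nn_integral_cmult L ennreal_mult L0)
    finally show ?thesis .
  qed
  have "(\<lambda>n. ennreal (m powr h n * L)) \<longlonglongrightarrow> ennreal (m powr 0 * L)"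
    using m by (intro tendsto_ennrealI tendsto_intros h) auto
  then have lim: "liminf (\<lambda>n. ennreal (m powr h n * L)) = ennreal L"
    using m by (simp add: lim_imp_Liminf)
  have "(\<lambda>n. 1 + h n) \<longlonglongrightarrow> 1 + 0" by (intro tendsto_intros h)
  then have "(\<integral>\<^sup>+x. ennreal (\<bar>v t x\<bar> powr 1) \<partial>lborel) \<le> liminf (\<lambda>n. shrunk_energy (1 + h n) (h n) t)"
    using h by (intro nn_integral_liminf_shrink) auto
  also have "\<dots> \<le> liminf (\<lambda>n. ennreal (m powr h n * L))"
    by (intro Liminf_mono always_eventually allI le)
  finally show ?thesis unfolding lim by (simp add: L_def)
qed

text \<open>The energy decreases in time, so s times its value at 2s is at most its integral over
  [s, 2s]. There the Nash bound applies, and the dissipation accumulated over that interval is at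
  most twice the energy at s.\<close>

lemma shrunk_energy_doubling:
  assumes p: "1 < p" and k: "0 < k" and s: "0 < s" and C: "0 \<le> C1" "0 \<le> C2"
    and nash: "\<And>t. 0 < t \<Longrightarrow> shrunk_energy p k t \<le> ennreal C1 * diss p (\<lambda>x. shrink k (v t x)) + ennreal C2"
  shows "s * enn2real (shrunk_energy p k (2 * s)) \<le> 2 * C1 * enn2real (shrunk_energy p k s) + s * C2"
proof -
  have fin: "\<exists>r\<ge>0. shrunk_energy p k t = ennreal r" if "0 < t" for t
  proof -
    have "(\<integral>\<^sup>+x. ennreal (\<bar>u0 x\<bar> powr p) \<partial>lborel) = ennreal (\<integral>x. \<bar>u0 x\<bar> powr p \<partial>lborel)"
      using p by (intro nn_integral_eq_integral u0_powr_integrable) auto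
    then have "shrunk_energy p k t < \<infinity>"
      using shrunk_energy_le_initial[OF p k that] by (auto intro: le_less_trans)
    then show ?thesis by (cases "shrunk_energy p k t") auto
  qed
  obtain a where a: "0 \<le> a" "shrunk_energy p k (2 * s) = ennreal a" using fin[of "2 * s"] s by auto
  obtain b where b: "0 \<le> b" "shrunk_energy p k s = ennreal b" using fin[of s] s by auto
  define D where "D = (\<lambda>t. diss p (\<lambda>x. shrink k (v t x)))"
  have vr[measurable (raw)]: "(\<lambda>z. v (a z) (b z)) \<in> borel_measurable Z"
    if "a \<in> Z \<rightarrow>\<^sub>M borel" "b \<in> Z \<rightarrow>\<^sub>M borel" for a b and Z :: "'z measure"
    using measurable_compose[OF measurable_Pair[OF that] v_measurable] by simp
  have [measurable]: "D \<in> borel_measurable lborel" unfolding D_def diss_def by measurable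
  have "ennreal (s * a) = (\<integral>\<^sup>+t. ennreal a * indicator {s..2 * s} t \<partial>lborel)"
    using s a by (subst nn_integral_cmult_indicator) (auto simp: ennreal_mult mult.commute)
  also have "\<dots> \<le> (\<integral>\<^sup>+t. ennreal C1 * (indicator {s..2 * s} t * D t) + ennreal C2 * indicator {s..2 * s} t \<partial>lborel)"
  proof (intro nn_integral_mono)
    fix t :: real
    show "ennreal a * indicator {s..2 * s} t \<le> ennreal C1 * (indicator {s..2 * s} t * D t) + ennreal C2 * indicator {s..2 * s} t"
    proof (cases "t \<in> {s..2 * s}")
      case True
      then have "ennreal a \<le> shrunk_energy p k t"
        unfolding a(2)[symmetric] using s by (intro shrunk_energy_antimono p k) auto
      also have "\<dots> \<le> ennreal C1 * D t + ennreal C2" unfolding D_def using True s by (intro nash) auto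
      finally show ?thesis using True by simp
    qed simp
  qed
  also have "\<dots> = ennreal C1 * (\<integral>\<^sup>+t. indicator {s..2 * s} t * D t \<partial>lborel) + ennreal C2 * emeasure lborel {s..2 * s}"
    by (subst nn_integral_add) (auto simp: nn_integral_cmult nn_integral_cmult_indicator)
  also have "\<dots> \<le> ennreal C1 * (2 * ennreal b) + ennreal C2 * ennreal s"
  proof (intro add_mono mult_left_mono)
    have "(\<integral>\<^sup>+t. indicator {s..2 * s} t * D t \<partial>lborel)
        \<le> 2 * shrunk_energy p k (2 * s) + (\<integral>\<^sup>+t. indicator {s..2 * s} t * D t \<partial>lborel)" by simp
    also have "\<dots> \<le> 2 * shrunk_energy p k s"
      unfolding D_def using s by (intro shrunk_energy_dissipation p k) auto
    finally show "(\<integral>\<^sup>+t. indicator {s..2 * s} t * D t \<partial>lborel) \<le> 2 * ennreal b" by (simp add: b)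
  qed (use s in auto)
  also have "2 * ennreal b = ennreal (2 * b)" using b by (simp add: ennreal_mult)
  also have "ennreal C1 * ennreal (2 * b) + ennreal C2 * ennreal s = ennreal (2 * C1 * b + s * C2)"
    using C b s by (simp add: ennreal_mult[symmetric] ennreal_plus[symmetric] mult_ac del: ennreal_plus)
  finally have "s * a \<le> 2 * C1 * b + s * C2"
    using C b s by (subst (asm) ennreal_le_iff) auto
  then show ?thesis using a b by simp
qed

end

text \<open>The number 2K is the fixed point of z/2 + K, and the excess z - 2K is at least halved
  when time doubles. Hence t (z t - 2K) does not grow under doubling, and induction on the number of
  doublings leads back to (0, 2 s0].\<close>

lemma doubling_decay:
  fixes z :: "real \<Rightarrow> real"
  assumes s0: "0 < s0" and rec: "\<And>s. s0 \<le> s \<Longrightarrow> z (2 * s) \<le> z s / 2 + K"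
    and init: "\<And>t. 0 < t \<Longrightarrow> t \<le> 2 * s0 \<Longrightarrow> z t \<le> A" and A: "0 \<le> A" and K: "0 \<le> K" and t: "0 < t"
  shows "z t \<le> A * min 1 (2 * s0 / t) + 2 * K"
proof -
  have *: "0 < t \<Longrightarrow> t \<le> 2 ^ j * (2 * s0) \<Longrightarrow> t * (z t - 2 * K) \<le> 2 * s0 * A" for j t
  proof (induction j arbitrary: t)
    case 0
    then have "z t - 2 * K \<le> A" using init[of t] K by auto
    then have "t * (z t - 2 * K) \<le> t * A" using 0 by (intro mult_left_mono) auto
    also have "\<dots> \<le> 2 * s0 * A" using 0 A by (intro mult_right_mono) auto
    finally show ?case .
  next
    case (Suc j)
    show ?case
    proof (cases "t \<le> 2 * s0")
      case True
      then have "z t - 2 * K \<le> A" using init[of t] K Suc by auto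
      then have "t * (z t - 2 * K) \<le> t * A" using Suc by (intro mult_left_mono) auto
      also have "\<dots> \<le> 2 * s0 * A" using True A by (intro mult_right_mono) auto
      finally show ?thesis .
    next
      case False
      then have "z t - 2 * K \<le> (z (t / 2) - 2 * K) / 2" using rec[of "t / 2"] by simp
      then have "t * (z t - 2 * K) \<le> t * ((z (t / 2) - 2 * K) / 2)" using Suc by (intro mult_left_mono) auto
      also have "\<dots> = t / 2 * (z (t / 2) - 2 * K)" by simp
      also have "\<dots> \<le> 2 * s0 * A" using Suc by (intro Suc.IH) auto
      finally show ?thesis .
    qed
  qed
  \<comment> \<open>Enough doublings to reach t from the initial interval; the bound obtained does
    not depend on j.\<close>
  obtain j :: nat where "t / (2 * s0) < 2 ^ j" using real_arch_pow[of 2] by auto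
  then have "t \<le> 2 ^ j * (2 * s0)" using s0 by (simp add: field_simps)
  then have "t * (z t - 2 * K) \<le> 2 * s0 * A" using t by (intro *)
  then have 1: "z t \<le> A * (2 * s0 / t) + 2 * K" using t by (simp add: field_simps)
  show ?thesis
  proof (cases "t \<le> 2 * s0")
    case True
    then have "min 1 (2 * s0 / t) = 1" using t by simp
    then show ?thesis using init[OF t True] K by simp
  next
    case False
    then have "min 1 (2 * s0 / t) = 2 * s0 / t" using t by (simp add: min_def field_simps)
    then show ?thesis using 1 by simp
  qed
qed

section \<open>Decay of L^p integrals with constants depending only on the kernel and p\<close>

context nonlocal_kernel
begin

text \<open>The two data terms are kept apart: the L^p term carries a factor that vanishes as t
  grows, so the limit superior sees only the L^1 norm, while bounding that factor by 1 gives an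
  estimate for all times.\<close>

lemma Lp_decay:
  assumes p: "1 < p"
  defines "\<alpha> \<equiv> real DIM('a) * (p - 1) / (2 * \<sigma>)"
  shows "\<exists>A>0. \<exists>K>0. \<exists>\<tau>>0. \<forall>u0 v. regular_solution J B c1 c2 \<sigma> u0 v \<longrightarrow> (\<forall>t>0.
    (\<integral>\<^sup>+x. ennreal (\<bar>v t x\<bar> powr p) \<partial>lborel)
      \<le> ennreal (t powr (- \<alpha>) * (A * (\<integral>x. \<bar>u0 x\<bar> powr p \<partial>lborel) * min 1 (\<tau> / t)
          + K * (\<integral>x. \<bar>u0 x\<bar> \<partial>lborel) powr p)))"
proof -
  obtain C1 C2 where C: "0 < C1" "0 < C2" and nash: "\<And>w L \<rho>. w \<in> borel_measurable borel \<Longrightarrow> 0 \<le> L \<Longrightarrow>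
    (\<integral>\<^sup>+x. ennreal \<bar>w x\<bar> \<partial>lborel) \<le> ennreal L \<Longrightarrow> c2 \<le> \<rho> \<Longrightarrow>
    (\<integral>\<^sup>+x. ennreal (\<bar>w x\<bar> powr p) \<partial>lborel) \<le>
      ennreal (C1 * \<rho> powr (2 * \<sigma>)) * diss p w
      + ennreal (C2 * \<rho> powr (- (real DIM('a) * (p - 1))) * L powr p)"
    using nash_inequality[OF p] by (elim exE conjE) blast
  have \<alpha>: "0 \<le> \<alpha>" using p \<sigma>_pos by (simp add: \<alpha>_def)
  \<comment> \<open>Makes the coefficient 2 C1 \<delta> 2^\<alpha> of the recursion for t^\<alpha>
    times the energy equal to 1/2.\<close>
  define \<delta> where "\<delta> = 1 / (4 * C1 * 2 powr \<alpha>)"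
  have \<delta>: "0 < \<delta>" using C by (simp add: \<delta>_def)
  \<comment> \<open>From this time on the radius \<rho> with \<rho>^(2\<sigma>) = \<delta> s is at
    least \<open>c2\<close>, as the Nash inequality requires.\<close>
  define s0 where "s0 = c2 powr (2 * \<sigma>) / \<delta>"
  have s0: "0 < s0" using c2_pos \<delta> by (simp add: s0_def)
  \<comment> \<open>What remains of the L^1 term: \<rho>^(-n(p-1)) equals (\<delta> s)^(-\<alpha>),
    and its power of s cancels against the weight (2s)^\<alpha> up to 2^\<alpha>.\<close>
  define K where "K = C2 * 2 powr \<alpha> * \<delta> powr (- \<alpha>)"
  have K: "0 < K" using C \<delta> by (simp add: K_def)
  have "(\<integral>\<^sup>+x. ennreal (\<bar>v t x\<bar> powr p) \<partial>lborel)
      \<le> ennreal (t powr (- \<alpha>) * ((2 * s0) powr \<alpha> * (\<integral>x. \<bar>u0 x\<bar> powr p \<partial>lborel) * min 1 (2 * s0 / t)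
          + 2 * K * (\<integral>x. \<bar>u0 x\<bar> \<partial>lborel) powr p))"
    if reg: "regular_solution J B c1 c2 \<sigma> u0 v" and t: "0 < t" for u0 v t
  proof -
    interpret regular_solution J B c1 c2 \<sigma> u0 v by (rule reg)
    define L where "L = (\<integral>x. \<bar>u0 x\<bar> \<partial>lborel)"
    define Y where "Y = (\<integral>x. \<bar>u0 x\<bar> powr p \<partial>lborel)"
    have L: "0 \<le> L" by (simp add: L_def)
    have Y: "0 \<le> Y" by (simp add: Y_def)
    have "shrunk_energy p k t \<le> ennreal (t powr (- \<alpha>) * ((2 * s0) powr \<alpha> * Y * min 1 (2 * s0 / t) + 2 * K * L powr p))"
      if k: "0 < k" for k
    proof -
      define y where "y = (\<lambda>t. enn2real (shrunk_energy p k t))"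
      have seY: "shrunk_energy p k t \<le> ennreal Y" if "0 < t" for t
      proof -
        have "(\<integral>\<^sup>+x. ennreal (\<bar>u0 x\<bar> powr p) \<partial>lborel) = ennreal Y"
          unfolding Y_def using p by (intro nn_integral_eq_integral u0_powr_integrable) auto
        then show ?thesis using shrunk_energy_le_initial[OF p k that] by simp
      qed
      have se: "shrunk_energy p k t = ennreal (y t)" if "0 < t" for t
        using seY[OF that] unfolding y_def by (cases "shrunk_energy p k t") (auto simp: top_unique)
      have y0: "0 \<le> y t" for t by (simp add: y_def)
      have yY: "y t \<le> Y" if "0 < t" for t
        using seY[OF that] se[OF that] Y by simp
      define z where "z = (\<lambda>t. t powr \<alpha> * y t)"
      have "z (2 * s) \<le> z s / 2 + K * L powr p" if s: "s0 \<le> s" for s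
      proof -
        have s': "0 < s" using s s0 by simp
        define \<rho> where "\<rho> = (\<delta> * s) powr (1 / (2 * \<sigma>))"
        have \<rho>1: "\<rho> powr (2 * \<sigma>) = \<delta> * s" using \<delta> s' \<sigma>_pos by (simp add: \<rho>_def powr_powr)
        have \<rho>2: "\<rho> powr (- (real DIM('a) * (p - 1))) = \<delta> powr (- \<alpha>) * s powr (- \<alpha>)"
          using \<delta> s' \<sigma>_pos by (simp add: \<rho>_def powr_powr \<alpha>_def powr_mult)
        have "c2 powr (2 * \<sigma>) \<le> \<delta> * s" using s \<delta> by (simp add: s0_def field_simps)
        then have "(c2 powr (2 * \<sigma>)) powr (1 / (2 * \<sigma>)) \<le> \<rho>"
          unfolding \<rho>_def using \<sigma>_pos by (intro powr_mono2) auto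
        then have \<rho>c: "c2 \<le> \<rho>" using c2_pos \<sigma>_pos by (simp add: powr_powr)
        have "s * y (2 * s) \<le> 2 * (C1 * (\<delta> * s)) * y s + s * (C2 * (\<delta> powr (- \<alpha>) * s powr (- \<alpha>)) * L powr p)"
          unfolding y_def
        proof (rule shrunk_energy_doubling[OF p k s'])
          fix t :: real assume t: "0 < t"
          have "(\<integral>\<^sup>+x. ennreal \<bar>shrink k (v t x)\<bar> \<partial>lborel) \<le> (\<integral>\<^sup>+x. ennreal \<bar>v t x\<bar> \<partial>lborel)"
            using k by (intro nn_integral_mono ennreal_leI abs_shrink_le) auto
          also have "\<dots> \<le> ennreal L" unfolding L_def by (rule L1_contraction[OF t])
          finally show "shrunk_energy p k t \<le> ennreal (C1 * (\<delta> * s)) * diss p (\<lambda>x. shrink k (v t x)) +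
              ennreal (C2 * (\<delta> powr (- \<alpha>) * s powr (- \<alpha>)) * L powr p)"
            unfolding shrunk_energy_def \<rho>1[symmetric] \<rho>2[symmetric]
            by (intro nash \<rho>c L) measurable
        qed (use C \<delta> s' in auto)
        also have "\<dots> = s * (2 * C1 * \<delta> * y s + C2 * \<delta> powr (- \<alpha>) * s powr (- \<alpha>) * L powr p)"
          by (simp add: algebra_simps)
        finally have "y (2 * s) \<le> 2 * C1 * \<delta> * y s + C2 * \<delta> powr (- \<alpha>) * s powr (- \<alpha>) * L powr p"
          using s' by simp
        then have "z (2 * s) \<le> (2 * s) powr \<alpha> * (2 * C1 * \<delta> * y s + C2 * \<delta> powr (- \<alpha>) * s powr (- \<alpha>) * L powr p)"
          unfolding z_def by (intro mult_left_mono) auto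
        also have "\<dots> = (2 * C1 * \<delta> * 2 powr \<alpha>) * (s powr \<alpha> * y s)
            + C2 * 2 powr \<alpha> * \<delta> powr (- \<alpha>) * (s powr \<alpha> * s powr (- \<alpha>)) * L powr p"
          using s' by (simp add: powr_mult algebra_simps)
        also have "2 * C1 * \<delta> * 2 powr \<alpha> = 1 / 2" using C by (simp add: \<delta>_def)
        also have "s powr \<alpha> * s powr (- \<alpha>) = 1" using s' by (simp add: powr_add[symmetric])
        finally show ?thesis by (simp add: z_def K_def)
      qed
      then have "z t \<le> (2 * s0) powr \<alpha> * Y * min 1 (2 * s0 / t) + 2 * (K * L powr p)"
      \<comment> \<open>On the initial interval the energy is at most that of the datum and the
        weight at most (2 s0)^\<alpha>, which is the source of the first constant.\<close>
      proof (rule doubling_decay[OF s0 _ _ _ _ t])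
        fix t :: real assume t: "0 < t" "t \<le> 2 * s0"
        then have "t powr \<alpha> \<le> (2 * s0) powr \<alpha>" using \<alpha> by (intro powr_mono2) auto
        then show "z t \<le> (2 * s0) powr \<alpha> * Y"
          unfolding z_def using yY[OF t(1)] y0 by (intro mult_mono) auto
      qed (use K L Y in auto)
      then have "t powr (- \<alpha>) * z t \<le> t powr (- \<alpha>) * ((2 * s0) powr \<alpha> * Y * min 1 (2 * s0 / t) + 2 * K * L powr p)"
        by (intro mult_left_mono) (auto simp: mult.assoc)
      moreover have "t powr (- \<alpha>) * z t = y t"
        using t by (simp add: z_def mult.assoc[symmetric] powr_add[symmetric])
      ultimately show ?thesis unfolding se[OF t] by (intro ennreal_leI) simp
    qed
    then show ?thesis using p unfolding L_def Y_def by (intro nn_integral_powr_le_if_shrunk) auto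
  qed
  moreover have "0 < (2 * s0) powr \<alpha>" "0 < 2 * K" "0 < 2 * s0" using s0 K by auto
  ultimately show ?thesis by meson
qed

end

section \<open>Interpolation between L^1 and L^r\<close>

lemma L1_Linf_powr_integrable:
  assumes "f \<in> L1_Linf" "1 \<le> p"
  shows "integrable lebesgue (\<lambda>x. \<bar>f x\<bar> powr p)"
proof -
  obtain M where "AE x in lebesgue. \<bar>f x\<bar> \<le> M" using L1_Linf_bounded[OF assms(1)] by blast
  then show ?thesis using assms by (intro integrable_powr_if_bounded) (auto simp: L1_Linf_def)
qed

text \<open>After division by the maximum m of the two norms, s^q \<le> s + s^r for s \<ge> 0 is
  integrated, and each term contributes at most 1. The cruder factor 2 replaces Hoelder's
  inequality.\<close>

lemma Lp_interpolation:
  fixes f :: "'a::euclidean_space \<Rightarrow> real"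
  assumes f: "f \<in> L1_Linf" and q: "1 < q" "q \<le> r"
  shows "(\<integral>x. \<bar>f x\<bar> powr q \<partial>lebesgue) \<le> 2 * max (Lp_norm 1 f) (Lp_norm r f) powr q"
proof -
  define m where "m = max (Lp_norm 1 f) (Lp_norm r f)"
  have fi: "integrable lebesgue f" using f by (simp add: L1_Linf_def)
  have m0: "0 \<le> m" by (simp add: m_def Lp_norm_1 le_max_iff_disj)
  have m1: "(\<integral>x. \<bar>f x\<bar> \<partial>lebesgue) \<le> m" by (simp add: m_def Lp_norm_1)
  have "Lp_norm r f powr r \<le> m powr r"
    using q by (intro powr_mono2) (auto simp: m_def Lp_norm_def)
  moreover have "Lp_norm r f powr r = (\<integral>x. \<bar>f x\<bar> powr r \<partial>lebesgue)"
    using q by (simp add: Lp_norm_def powr_powr)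
  ultimately have mr: "(\<integral>x. \<bar>f x\<bar> powr r \<partial>lebesgue) \<le> m powr r" by simp
  \<comment> \<open>The case m = 0 is separate because f cannot be scaled by m; f then vanishes
    almost everywhere.\<close>
  show ?thesis
  proof (cases "m = 0")
    case True
    then have "(\<integral>x. \<bar>f x\<bar> \<partial>lebesgue) = 0"
      using m1 by (intro antisym) auto
    then have "AE x in lebesgue. \<bar>f x\<bar> = 0"
      using fi by (subst (asm) integral_nonneg_eq_0_iff_AE) auto
    then have "(\<integral>x. \<bar>f x\<bar> powr q \<partial>lebesgue) = 0"
      by (intro integral_eq_zero_AE) auto
    then show ?thesis by simp
  next
    case False
    then have m: "0 < m" using m0 by simp
    have "\<bar>f x\<bar> powr q \<le> m powr q * (\<bar>f x\<bar> / m + \<bar>f x\<bar> powr r / m powr r)" for x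
    proof -
      define s where "s = \<bar>f x\<bar> / m"
      have s: "0 \<le> s" using m by (simp add: s_def)
      have "s powr q \<le> s + s powr r"
      proof (cases "s \<le> 1")
        case True
        then have "s powr q \<le> s powr 1" using q s by (intro powr_mono') auto
        then have "s powr q \<le> s" using s by simp
        moreover have "0 \<le> s powr r" by simp
        ultimately show ?thesis by linarith
      next
        case False
        then have "s powr q \<le> s powr r" using q(2) by (intro powr_mono) auto
        then show ?thesis using s by linarith
      qed
      then have "m powr q * s powr q \<le> m powr q * (s + s powr r)" by (intro mult_left_mono) auto
      then show ?thesis using m by (simp add: s_def powr_divide)
    qed
    then have "(\<integral>x. \<bar>f x\<bar> powr q \<partial>lebesgue) \<le> (\<integral>x. m powr q * (\<bar>f x\<bar> / m + \<bar>f x\<bar> powr r / m powr r) \<partial>lebesgue)"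
      using q fi f by (intro integral_mono integrable_mult_right Bochner_Integration.integrable_add
          integrable_divide L1_Linf_powr_integrable) auto
    also have "\<dots> = m powr q * ((\<integral>x. \<bar>f x\<bar> \<partial>lebesgue) / m + (\<integral>x. \<bar>f x\<bar> powr r \<partial>lebesgue) / m powr r)"
      using q fi f by (simp add: Bochner_Integration.integral_add L1_Linf_powr_integrable)
    also have "\<dots> \<le> m powr q * (1 + 1)"
      using m m1 mr by (intro mult_left_mono add_mono) (auto simp: field_simps)
    finally show ?thesis by (simp add: m_def)
  qed
qed

section \<open>Transfer between the given solution and its Borel representative\<close>

context nonlocal_kernel
begin

text \<open>The datum also needs a Borel version \<open>w\<close>, since \<open>u0\<close> is only
  Lebesgue measurable. Uniform closeness at time 0 passes from \<open>u\<close> to \<open>v\<close>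
  through finitely many almost-everywhere equalities at each t.\<close>

lemma regular_solution_exists:
  assumes u0: "u0 \<in> L1_Linf" and sol: "nonlocal_solution J u0 u"
  obtains w v where "regular_solution J B c1 c2 \<sigma> w v" "AE x in lebesgue. w x = u0 x"
    "\<And>t. 0 < t \<Longrightarrow> AE x in lebesgue. v t x = u t x"
proof -
  have J: "J x \<in> borel_measurable borel" for x by measurable
  obtain v where v: "(\<lambda>(t, x). v t x) \<in> borel_measurable (borel \<Otimes>\<^sub>M borel)"
    and vu: "\<And>t. 0 < t \<Longrightarrow> AE x in lebesgue. v t x = u t x"
    and vd: "AE x in lborel. \<forall>t>0.
      ((\<lambda>s. v s x) has_real_derivative (\<integral>y. J x y * (v t y - v t x) \<partial>lborel)) (at t)"
    and vb: "\<And>T. \<exists>M. \<forall>t x. 0 < t \<longrightarrow> t \<le> T \<longrightarrow> \<bar>v t x\<bar> \<le> M"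
    by (rule nonlocal_solution_representative[OF sol J]) (rule that)
  have C: "C_L1_Linf u" and u00: "AE x in lebesgue. u 0 x = u0 x"
    using sol by (auto simp: nonlocal_solution_def)
  have u0i: "integrable lebesgue u0" using u0 by (simp add: L1_Linf_def)
  obtain w where w[measurable]: "w \<in> borel_measurable lborel" and "AE x in lborel. u0 x = w x"
    using completion_ex_borel_measurable_real[OF borel_measurable_integrable[OF u0i]] by blast
  then have wu: "AE x in lebesgue. w x = u0 x" by (auto simp: AE_completion_iff)
  have "regular_solution J B c1 c2 \<sigma> w v"
  proof (unfold_locales, rule v, rule vd, rule vb)
    show "\<exists>L. \<forall>t. 0 < t \<longrightarrow> t \<le> T \<longrightarrow> (\<integral>\<^sup>+x. ennreal \<bar>v t x\<bar> \<partial>lborel) \<le> ennreal L" for T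
    proof (cases "0 \<le> T")
      case True
      obtain M where M: "\<forall>t\<in>{0..T}. (AE x in lebesgue. \<bar>u t x\<bar> \<le> M) \<and> (\<integral>x. \<bar>u t x\<bar> \<partial>lebesgue) \<le> M"
        using C_L1_Linf_bounded[OF C True] by blast
      have "(\<integral>\<^sup>+x. ennreal \<bar>v t x\<bar> \<partial>lborel) \<le> ennreal M" if t: "0 < t" "t \<le> T" for t
      proof -
        have "(\<integral>\<^sup>+x. ennreal \<bar>v t x\<bar> \<partial>lborel) = (\<integral>\<^sup>+x. ennreal \<bar>v t x\<bar> \<partial>lebesgue)"
          by (simp add: nn_integral_completion)
        also have "\<dots> = (\<integral>\<^sup>+x. ennreal \<bar>u t x\<bar> \<partial>lebesgue)"
          by (rule nn_integral_cong_AE) (use vu[OF t(1)] in eventually_elim, simp)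
        also have "\<dots> = ennreal (\<integral>x. \<bar>u t x\<bar> \<partial>lebesgue)"
          using C t by (intro nn_integral_eq_integral) (auto simp: C_L1_Linf_def L1_Linf_def)
        also have "\<dots> \<le> ennreal M" using M t by (intro ennreal_leI) simp
        finally show ?thesis .
      qed
      then show ?thesis by blast
    qed auto
    show "\<exists>d>0. \<forall>t. 0 < t \<longrightarrow> t < d \<longrightarrow> (AE x in lborel. \<bar>v t x - w x\<bar> \<le> e)" if e: "0 < e" for e
    proof -
      obtain d where d: "0 < d" "\<forall>s\<ge>0. \<bar>s - 0\<bar> < d \<longrightarrow>
        (AE x in lebesgue. \<bar>u s x - u 0 x\<bar> \<le> e) \<and> (\<integral>x. \<bar>u s x - u 0 x\<bar> \<partial>lebesgue) \<le> e"
        using C_L1_Linf_locally_close[OF C order_refl e] by blast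
      have "AE x in lborel. \<bar>v t x - w x\<bar> \<le> e" if t: "0 < t" "t < d" for t
      proof -
        have "AE x in lebesgue. \<bar>u t x - u 0 x\<bar> \<le> e" using d(2) t by simp
        then have "AE x in lebesgue. \<bar>v t x - w x\<bar> \<le> e"
          using vu[OF t(1)] u00 wu by eventually_elim simp
        then show ?thesis by (simp add: AE_completion_iff)
      qed
      then show ?thesis using d(1) by blast
    qed
    have "integrable lebesgue w"
      using u0i wu w by (subst integrable_cong_AE[of w _ u0])
        (auto simp: measurable_completion intro: borel_measurable_integrable)
    then show "integrable lborel w" using w by (subst (asm) integrable_completion) auto
    obtain M where "AE x in lebesgue. \<bar>u0 x\<bar> \<le> M" using L1_Linf_bounded[OF u0] by blast
    then have "AE x in lebesgue. \<bar>w x\<bar> \<le> M" using wu by eventually_elim simp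
    then show "\<exists>M. AE x in lborel. \<bar>w x\<bar> \<le> M" by (auto simp: AE_completion_iff)
  qed
  then show ?thesis by (rule that[OF _ wu]) (rule vu)
qed

lemma nonlocal_solution_Lp_decay:
  assumes p: "1 < p"
  defines "\<alpha> \<equiv> real DIM('a) * (p - 1) / (2 * \<sigma>)"
  shows "\<exists>A>0. \<exists>K>0. \<exists>\<tau>>0. \<forall>u0 u. u0 \<in> L1_Linf \<longrightarrow> nonlocal_solution J u0 u \<longrightarrow> (\<forall>t>0.
    (\<integral>x. \<bar>u t x\<bar> powr p \<partial>lebesgue)
      \<le> t powr (- \<alpha>) * (A * (\<integral>x. \<bar>u0 x\<bar> powr p \<partial>lebesgue) * min 1 (\<tau> / t) + K * Lp_norm 1 u0 powr p))"
proof -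
  obtain A K \<tau> where A: "0 < A" and K: "0 < K" and \<tau>: "0 < \<tau>"
    and decay: "\<forall>w v. regular_solution J B c1 c2 \<sigma> w v \<longrightarrow> (\<forall>t>0.
      (\<integral>\<^sup>+x. ennreal (\<bar>v t x\<bar> powr p) \<partial>lborel)
        \<le> ennreal (t powr (- \<alpha>) * (A * (\<integral>x. \<bar>w x\<bar> powr p \<partial>lborel) * min 1 (\<tau> / t)
            + K * (\<integral>x. \<bar>w x\<bar> \<partial>lborel) powr p)))"
    using Lp_decay[OF p, folded \<alpha>_def] by (elim exE conjE) (rule that, assumption+)
  have "(\<integral>x. \<bar>u t x\<bar> powr p \<partial>lebesgue)
      \<le> t powr (- \<alpha>) * (A * (\<integral>x. \<bar>u0 x\<bar> powr p \<partial>lebesgue) * min 1 (\<tau> / t) + K * Lp_norm 1 u0 powr p)"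
    if u0: "u0 \<in> L1_Linf" and sol: "nonlocal_solution J u0 u" and t: "0 < t" for u0 u t
  proof -
    obtain w v where reg: "regular_solution J B c1 c2 \<sigma> w v" and wu: "AE x in lebesgue. w x = u0 x"
      and vu: "\<And>t. 0 < t \<Longrightarrow> AE x in lebesgue. v t x = u t x"
      by (rule regular_solution_exists[OF u0 sol]) (rule that)
    interpret regular_solution J B c1 c2 \<sigma> w v by (rule reg)
    have u0m: "u0 \<in> borel_measurable lebesgue"
      using u0 by (auto simp: L1_Linf_def)
    have w_eq: "(\<integral>x. \<bar>w x\<bar> powr r \<partial>lborel) = (\<integral>x. \<bar>u0 x\<bar> powr r \<partial>lebesgue)" for r
    proof -
      have "(\<integral>x. \<bar>w x\<bar> powr r \<partial>lborel) = (\<integral>x. \<bar>w x\<bar> powr r \<partial>lebesgue)"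
        by (rule integral_completion[symmetric]) measurable
      also have "\<dots> = (\<integral>x. \<bar>u0 x\<bar> powr r \<partial>lebesgue)"
      proof (rule integral_cong_AE)
        have [measurable]: "u0 \<in> borel_measurable lebesgue" "w \<in> borel_measurable lebesgue"
          using u0m by (simp_all add: measurable_completion)
        show "(\<lambda>x. \<bar>w x\<bar> powr r) \<in> borel_measurable lebesgue"
          "(\<lambda>x. \<bar>u0 x\<bar> powr r) \<in> borel_measurable lebesgue" by measurable
        show "AE x in lebesgue. \<bar>w x\<bar> powr r = \<bar>u0 x\<bar> powr r" using wu by eventually_elim simp
      qed
      finally show ?thesis .
    qed
    define R where "R = t powr (- \<alpha>) * (A * (\<integral>x. \<bar>u0 x\<bar> powr p \<partial>lebesgue) * min 1 (\<tau> / t) + K * Lp_norm 1 u0 powr p)"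
    have R: "0 \<le> R" using A K \<tau> t unfolding R_def by (intro mult_nonneg_nonneg add_nonneg_nonneg) auto
    have uL: "u t \<in> L1_Linf" using sol t by (simp add: nonlocal_solution_def C_L1_Linf_def)
    \<comment> \<open>Membership of \<open>u t\<close> in \<open>L1_Linf\<close> makes the power
      integrable, so the Bochner integral is the true one and not the default value 0.\<close>
    have "ennreal (\<integral>x. \<bar>u t x\<bar> powr p \<partial>lebesgue) = (\<integral>\<^sup>+x. ennreal (\<bar>u t x\<bar> powr p) \<partial>lebesgue)"
      using p by (intro nn_integral_eq_integral[symmetric] L1_Linf_powr_integrable uL) auto
    also have "\<dots> = (\<integral>\<^sup>+x. ennreal (\<bar>v t x\<bar> powr p) \<partial>lebesgue)"
      by (rule nn_integral_cong_AE) (use vu[OF t] in eventually_elim, simp)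
    also have "\<dots> = (\<integral>\<^sup>+x. ennreal (\<bar>v t x\<bar> powr p) \<partial>lborel)"
      by (simp add: nn_integral_completion)
    also have "\<dots> \<le> ennreal R"
      using decay[rule_format, OF reg t] w_eq[of p] w_eq[of 1] by (simp add: R_def Lp_norm_1)
    finally show ?thesis unfolding R_def[symmetric] using R by simp
  qed
  then show ?thesis using A K \<tau> by meson
qed

end

section \<open>From decay of L^q integrals to the two norm estimates\<close>

theorem corollary1p2:
  fixes J :: "real ^ 'n \<Rightarrow> real ^ 'n \<Rightarrow> real" and \<sigma> q :: real
  assumes "CARD('n) \<ge> 2"
    and "0 < \<sigma>" "\<sigma> < 1"
    and "\<And>x y. J x y \<ge> 0"
    and "bounded (range (\<lambda>(x, y). J x y))"
    and "continuous_on UNIV (\<lambda>(x, y). J x y)"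
    and "\<And>x y. J x y = J y x"
    and "\<And>y. integrable lebesgue (\<lambda>x. J x y)"
    and "\<exists>c1>0. \<exists>c2>0. \<forall>x y. norm (x - y) > c2 \<longrightarrow>
           J x y \<ge> c1 * norm (x - y) powr (- (real CARD('n) + 2 * \<sigma>))"
    and "1 < q" "q \<le> 2 * \<sigma>"
  shows "(\<exists>C>0. \<forall>u0 u. u0 \<in> L1_Linf \<longrightarrow> nonlocal_solution J u0 u \<longrightarrow>
            Limsup at_top (\<lambda>t. ereal (t powr (real CARD('n) / (2 * \<sigma>) * (1 - 1 / q)) * Lp_norm q (u t)))
              \<le> ereal (C * Lp_norm 1 u0)) \<and>
         (\<forall>r>2 * \<sigma>. \<exists>C>0. \<forall>u0 u. u0 \<in> L1_Linf \<longrightarrow> nonlocal_solution J u0 u \<longrightarrow>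
            (\<forall>t>0. Lp_norm q (u t)
               \<le> C * max (Lp_norm 1 u0) (Lp_norm r u0) * t powr (- (real CARD('n) / (2 * \<sigma>) * (1 - 1 / q)))))"
proof -
  obtain B where "\<forall>z\<in>range (\<lambda>(x, y). J x y). norm z \<le> B"
    using assms(5) unfolding bounded_iff by blast
  then have "\<bar>J x y\<bar> \<le> B" for x y by (auto simp: image_iff)
  then have B: "J x y \<le> B" for x y by (rule order_trans[OF abs_ge_self])
  obtain c1 c2 where c: "0 < c1" "0 < c2" and J_ge: "\<And>x y. norm (x - y) > c2 \<Longrightarrow>
      J x y \<ge> c1 * norm (x - y) powr (- (real CARD('n) + 2 * \<sigma>))"
    using assms(9) by blast
  have Jm: "(\<lambda>(x, y). J x y) \<in> borel_measurable (borel \<Otimes>\<^sub>M borel)"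
    using borel_measurable_continuous_onI[OF assms(6)] by (simp add: borel_prod)
  have Ji: "integrable lborel (J x)" for x
  proof -
    have "J x \<in> borel_measurable lborel"
      using measurable_compose[OF _ Jm, of "\<lambda>y. (x, y)"] by simp
    \<comment> \<open>Integrability is given in the first argument; symmetry moves it to the second,
      over which the equation integrates.\<close>
    moreover have "(\<lambda>y. J y x) = J x" by (intro ext assms(7))
    then have "integrable lebesgue (J x)" using assms(8)[of x] by simp
    ultimately show ?thesis by (simp add: integrable_completion)
  qed
  interpret nonlocal_kernel J B c1 c2 \<sigma>
    by unfold_locales (use assms(2,4,7) B Jm Ji c J_ge in auto)
  define \<beta> where "\<beta> = real CARD('n) / (2 * \<sigma>) * (1 - 1 / q)"
  have q: "1 < q" by fact
  define \<alpha> where "\<alpha> = real CARD('n) * (q - 1) / (2 * \<sigma>)"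
  \<comment> \<open>\<alpha> is the rate for the q-th power of the norm; taking the q-th root turns
    it into the stated exponent \<beta>.\<close>
  have \<alpha>\<beta>: "\<alpha> * (1 / q) = \<beta>" using q assms(2) by (simp add: \<alpha>_def \<beta>_def field_simps)
  obtain A K \<tau> where A: "0 < A" and K: "0 < K" and \<tau>: "0 < \<tau>"
    and decay: "\<forall>u0 u. u0 \<in> L1_Linf \<longrightarrow> nonlocal_solution J u0 u \<longrightarrow> (\<forall>t>0.
      (\<integral>x. \<bar>u t x\<bar> powr q \<partial>lebesgue)
        \<le> t powr (- \<alpha>) * (A * (\<integral>x. \<bar>u0 x\<bar> powr q \<partial>lebesgue) * min 1 (\<tau> / t) + K * Lp_norm 1 u0 powr q))"
    using nonlocal_solution_Lp_decay[OF q, unfolded DIM_cart DIM_real mult_1_right, folded \<alpha>_def]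
    by (elim exE conjE) (rule that, assumption+)
  have Lq: "Lp_norm q (u t) \<le> t powr (- \<beta>) *
      (A * (\<integral>x. \<bar>u0 x\<bar> powr q \<partial>lebesgue) * min 1 (\<tau> / t) + K * Lp_norm 1 u0 powr q) powr (1 / q)"
    if "u0 \<in> L1_Linf" "nonlocal_solution J u0 u" "0 < t" for u0 u t
  proof -
    have "Lp_norm q (u t) \<le> (t powr (- \<alpha>) *
        (A * (\<integral>x. \<bar>u0 x\<bar> powr q \<partial>lebesgue) * min 1 (\<tau> / t) + K * Lp_norm 1 u0 powr q)) powr (1 / q)"
      unfolding Lp_norm_def[of q] using decay that q by (intro powr_mono2) auto
    also have "\<dots> = t powr (- \<beta>) *
      (A * (\<integral>x. \<bar>u0 x\<bar> powr q \<partial>lebesgue) * min 1 (\<tau> / t) + K * Lp_norm 1 u0 powr q) powr (1 / q)"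
      using \<alpha>\<beta> by (simp add: powr_mult powr_powr)
    finally show ?thesis .
  qed
  \<comment> \<open>The L^q norm of \<open>u0\<close> disappears in the limit since \<tau>/t tends
    to 0; only the L^1 term is left, whence the constant K^(1/q).\<close>
  have "Limsup at_top (\<lambda>t. ereal (t powr \<beta> * Lp_norm q (u t))) \<le> ereal (K powr (1 / q) * Lp_norm 1 u0)"
    if u0: "u0 \<in> L1_Linf" and sol: "nonlocal_solution J u0 u" for u0 u
  proof -
    define Y where "Y = (\<integral>x. \<bar>u0 x\<bar> powr q \<partial>lebesgue)"
    define M where "M = Lp_norm 1 u0"
    define g where "g = (\<lambda>t. (A * Y * min 1 (\<tau> / t) + K * M powr q) powr (1 / q))"
    have M: "0 \<le> M" by (simp add: M_def Lp_norm_def)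
    have "((\<lambda>t. \<tau> / t) \<longlongrightarrow> 0) at_top"
      by (intro tendsto_divide_0[OF tendsto_const] filterlim_at_top_imp_at_infinity filterlim_ident)
    then have "((\<lambda>t. A * Y * min 1 (\<tau> / t) + K * M powr q) \<longlongrightarrow> A * Y * min 1 0 + K * M powr q) at_top"
      by (intro tendsto_intros)
    moreover have "\<forall>\<^sub>F t in at_top. 0 \<le> A * Y * min 1 (\<tau> / t) + K * M powr q"
      using eventually_gt_at_top[of 0]
      by eventually_elim (use A K \<tau> in \<open>auto simp: Y_def intro!: add_nonneg_nonneg mult_nonneg_nonneg\<close>)
    ultimately have "(g \<longlongrightarrow> (A * Y * min 1 0 + K * M powr q) powr (1 / q)) at_top"
      unfolding g_def using q by (intro tendsto_powr' tendsto_const) auto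
    also have "(A * Y * min 1 0 + K * M powr q) powr (1 / q) = K powr (1 / q) * M"
      using M q by (simp add: powr_mult powr_powr)
    finally have lim: "((\<lambda>t. ereal (g t)) \<longlongrightarrow> ereal (K powr (1 / q) * M)) at_top" by simp
    have "\<forall>\<^sub>F t in at_top. ereal (t powr \<beta> * Lp_norm q (u t)) \<le> ereal (g t)"
      using eventually_gt_at_top[of 0]
    proof eventually_elim
      case (elim t)
      have "t powr \<beta> * Lp_norm q (u t) \<le> t powr \<beta> * (t powr (- \<beta>) * g t)"
        using Lq[OF u0 sol elim] by (intro mult_left_mono) (auto simp: g_def Y_def M_def)
      also have "\<dots> = g t" using elim by (simp add: mult.assoc[symmetric] powr_add[symmetric])
      finally show ?case by simp
    qed
    then have "Limsup at_top (\<lambda>t. ereal (t powr \<beta> * Lp_norm q (u t))) \<le> Limsup at_top (\<lambda>t. ereal (g t))"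
      by (rule Limsup_mono)
    also have "\<dots> = ereal (K powr (1 / q) * M)" by (rule lim_imp_Limsup[OF _ lim]) simp
    finally show ?thesis by (simp add: M_def)
  qed
  then have 1: "\<exists>C>0. \<forall>u0 u. u0 \<in> L1_Linf \<longrightarrow> nonlocal_solution J u0 u \<longrightarrow>
      Limsup at_top (\<lambda>t. ereal (t powr \<beta> * Lp_norm q (u t))) \<le> ereal (C * Lp_norm 1 u0)"
    using K by (intro exI[of _ "K powr (1 / q)"]) auto
  \<comment> \<open>In 2A + K the 2 comes from interpolation and the factor
    \<open>min 1 (\<tau> / t)\<close> is bounded by 1; the same constant serves every r.\<close>
  have "Lp_norm q (u t) \<le> (2 * A + K) powr (1 / q) * max (Lp_norm 1 u0) (Lp_norm r u0) * t powr (- \<beta>)"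
    if r: "2 * \<sigma> < r" and u0: "u0 \<in> L1_Linf" and sol: "nonlocal_solution J u0 u" and t: "0 < t" for r u0 u t
  proof -
    define m where "m = max (Lp_norm 1 u0) (Lp_norm r u0)"
    have m: "0 \<le> m" "Lp_norm 1 u0 \<le> m" by (auto simp: m_def Lp_norm_def le_max_iff_disj)
    \<comment> \<open>Here q \<le> 2\<sigma> < r places q between 1 and r, as the interpolation
      requires.\<close>
    have "(\<integral>x. \<bar>u0 x\<bar> powr q \<partial>lebesgue) * min 1 (\<tau> / t) \<le> (2 * m powr q) * 1"
      using Lp_interpolation[OF u0 q, of r] r assms(11) t \<tau> unfolding m_def[symmetric] by (intro mult_mono) auto
    then have "A * ((\<integral>x. \<bar>u0 x\<bar> powr q \<partial>lebesgue) * min 1 (\<tau> / t)) \<le> A * (2 * m powr q)"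
      using A by (intro mult_left_mono) auto
    moreover have "Lp_norm 1 u0 powr q \<le> m powr q"
      using m q by (intro powr_mono2) (auto simp: Lp_norm_def)
    then have "K * Lp_norm 1 u0 powr q \<le> K * m powr q"
      using K by (intro mult_left_mono) auto
    ultimately have le: "A * (\<integral>x. \<bar>u0 x\<bar> powr q \<partial>lebesgue) * min 1 (\<tau> / t) + K * Lp_norm 1 u0 powr q
        \<le> (2 * A + K) * m powr q"
      by (simp add: algebra_simps)
    have "(A * (\<integral>x. \<bar>u0 x\<bar> powr q \<partial>lebesgue) * min 1 (\<tau> / t) + K * Lp_norm 1 u0 powr q) powr (1 / q)
        \<le> ((2 * A + K) * m powr q) powr (1 / q)"
      using le q A K \<tau> t by (intro powr_mono2) auto
    also have "\<dots> = (2 * A + K) powr (1 / q) * m"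
      using m q by (simp add: powr_mult powr_powr)
    finally have "t powr (- \<beta>) * (A * (\<integral>x. \<bar>u0 x\<bar> powr q \<partial>lebesgue) * min 1 (\<tau> / t) + K * Lp_norm 1 u0 powr q) powr (1 / q)
        \<le> t powr (- \<beta>) * ((2 * A + K) powr (1 / q) * m)"
      by (intro mult_left_mono) auto
    then show ?thesis using Lq[OF u0 sol t] by (simp add: m_def mult_ac)
  qed
  then have "\<forall>r>2 * \<sigma>. \<exists>C>0. \<forall>u0 u. u0 \<in> L1_Linf \<longrightarrow> nonlocal_solution J u0 u \<longrightarrow>
      (\<forall>t>0. Lp_norm q (u t) \<le> C * max (Lp_norm 1 u0) (Lp_norm r u0) * t powr (- \<beta>))"
    using A K by (intro allI impI exI[of _ "(2 * A + K) powr (1 / q)"]) auto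
  with 1 show ?thesis unfolding \<beta>_def by blast
qed

end
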